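(* Let $\sigma:R_0\to R_1$ be a homomorphism of commutative rings with identity, and for $a\in\{0,1\}$ let $\mathcal F_a:\mathsf{OTa}\to\mathcal C_a$ be a strict monoidal functor from the oriented-tangle category to an $R_a$-linear monoidal category whose tensor unit is $R_a$ and such that every endomorphism of the tensor unit is multiplication by a scalar in $R_a$. For a closed oriented link $\mathcal L:\varnothing\to\varnothing$ let $I_a(\mathcal L)\in R_a$ be the unique scalar with $\mathcal F_a(\mathcal L)=I_a(\mathcal L)\,\mathrm{id}_{R_a}$. Assume that, after extension of coefficients $\sigma_*$ along $\sigma$, the two target categories are realized in a common $R_1$-linear category. Suppose that for every sign word $\mathbf X$ there is an invertible boundary comparison $$B_{\mathbf X}:\mathcal F_1(\mathbf X)\to\sigma_*\mathcal F_0(\mathbf X),\qquad B_\varnothing=\mathrm{id}_{R_1},$$ in this common category, and that these are coherent (as defined in the context). Suppose that every elementary slice $E:\mathbf X\to\mathbf Y$ satisfies $$\mathcal F_1(E)=\alpha(E)\,B_{\mathbf Y}^{-1}\,\sigma_*(\mathcal F_0(E))\,B_{\mathbf X}$$ for a unit $\alpha(E)\in R_1^\times$ (the local scalar defect), and that the defects respect the defining relations of $\mathsf{OTa}$, so that their products give a decomposition-independent scalar $\alpha(T)$ for every tangle $T$. Then every oriented tangle $T:\mathbf X\to\mathbf Y$ satisfies $$\mathcal F_1(T)=\alpha(T)\,B_{\mathbf Y}^{-1}\,\sigma_*(\mathcal F_0(T))\,B_{\mathbf X}.$$ For a closed oriented link $\mathcal L$, $$I_1(\mathcal L)=\alpha(\mathcal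 L)\,\sigma(I_0(\mathcal L)).$$ If every local defect equals $1$ (the transport is then called strict), the closed invariants are exactly equal after coefficient extension, i.e. $I_1(\mathcal L)=\sigma(I_0(\mathcal L))$.
   Context: **Tangle category.** $\mathsf{OTa}$ is the strict monoidal category whose objects are finite words in $\{+,-\}$ ($+$ = upward strand, $-$ = downward strand) and whose morphisms are isotopy classes (rel boundary) of oriented tangles in $\mathbb R^2\times[0,1]$ from the bottom word to the top word; composition is vertical stacking, tensor product is juxtaposition, unit is the empty word $\varnothing$. Apart from identity strands it is generated by six morphisms: the positive and negative crossings $X_\pm:(+,+)\to(+,+)$ and the four oriented caps and cups $(-,+)\to\varnothing$, $(+,-)\to\varnothing$, $\varnothing\to(-,+)$, $\varnothing\to(+,-)$. An elementary slice is a morphism $E=\mathrm{id}_{\mathbf U}\otimes G\otimes\mathrm{id}_{\mathbf V}:\mathbf X\to\mathbf Y$ with $\mathbf U,\mathbf V$ sign words and $G$ one of these six generators. Every oriented-tangle diagram can be cut by horizontal levels into layers that are elementary slices or identities. **Linear categories.** $R_a$-linear means that morphism sets are $R_a$-modules and that composition and tensor product of morphisms are $R_a$-bilinear. **Coefficient extension.** For an $R_0$-module $M$ and $R_0$-linear $f:M\to N$: $\sigma_*M=R_1\otimes_{R_0,\sigma}M$ and $\sigma_*f=\mathrm{id}_{R_1}\otimes f$, where $R_1$ is regarded as an $R_0$-module via $a\cdot r=a\sigma(r)$; $\sigma_*R_0$ is identified with $R_1$. Thus objects of $\mathcal C_0$ are understood to have underlying $R_0$-modules and morphisms to be $R_0$-linear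 maps; $\sigma_*$ is functorial and $\sigma_*(rf)=\sigma(r)\sigma_*(f)$. "Realized in a common $R_1$-linear category" means that the objects $\mathcal F_1(\mathbf X)$, $\sigma_*\mathcal F_0(\mathbf X)$ and the morphisms $\mathcal F_1(T)$, $\sigma_*\mathcal F_0(T)$ are objects and morphisms of one $R_1$-linear category, so that they can be compared by maps in that category. **Coherence.** Coherence of the $B_{\mathbf X}$ means that the comparison for a concatenated word is obtained by iterating the same two-factor comparison and is independent of parenthesization; that is, $B_{\mathbf X\mathbf Y}=J_{\mathbf X,\mathbf Y}\circ(B_{\mathbf X}\otimes B_{\mathbf Y})$ for a fixed two-factor comparison isomorphism $J_{\mathbf X,\mathbf Y}:\sigma_*\mathcal F_0(\mathbf X)\otimes\sigma_*\mathcal F_0(\mathbf Y)\to\sigma_*\mathcal F_0(\mathbf X\mathbf Y)$, with the result for longer words independent of parenthesization. **Defects.** Identity morphisms have defect $1$. Decomposition-independence means: if $T=E_k\circ\cdots\circ E_1$ is any decomposition of a tangle $T$ into elementary slices (and identities), the product $\alpha(E_k)\cdots\alpha(E_1)$ depends only on $T$; it is denoted $\alpha(T)$. *)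

theory Defs
  imports "HOL-Analysis.Analysis" "HOL-Algebra.Module" "HOL-Algebra.Free_Abelian_Groups"
    "HOL-Algebra.Generated_Groups" "HOL-Algebra.Coset" "HOL-Algebra.RingHom"
begin

section \<open>Monoidal and linear categories\<close>

text \<open>\<open>g \<star>\<^bsub>C\<^esub> f\<close> is \<open>g\<close> after \<open>f\<close>.  \<open>Asc A B C\<close> goes from \<open>(A \<otimes> B) \<otimes> C\<close> to \<open>A \<otimes> (B \<otimes> C)\<close>.\<close>

record ('o, 'a) monoidal_cat =
  Obj :: "'o set"
  Arr :: "'a set"
  Src :: "'a \<Rightarrow> 'o"
  Tgt :: "'a \<Rightarrow> 'o"
  Ide :: "'o \<Rightarrow> 'a"
  Cmp :: "'a \<Rightarrow> 'a \<Rightarrow> 'a"  (infixr \<open>\<star>\<index>\<close> 70)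
  Unt :: "'o"
  TObj :: "'o \<Rightarrow> 'o \<Rightarrow> 'o"  (infixr \<open>\<boxdot>\<index>\<close> 75)
  TArr :: "'a \<Rightarrow> 'a \<Rightarrow> 'a"  (infixr \<open>\<boxtimes>\<index>\<close> 75)
  Asc :: "'o \<Rightarrow> 'o \<Rightarrow> 'o \<Rightarrow> 'a"
  LUn :: "'o \<Rightarrow> 'a"
  RUn :: "'o \<Rightarrow> 'a"

definition Hom :: "('o, 'a, 'z) monoidal_cat_scheme \<Rightarrow> 'o \<Rightarrow> 'o \<Rightarrow> 'a set" where
  "Hom C A B = {f \<in> Arr C. Src C f = A \<and> Tgt C f = B}"

definition category :: "('o, 'a, 'z) monoidal_cat_scheme \<Rightarrow> bool" where
  "category C \<longleftrightarrow>
     (\<forall>f\<in>Arr C. Src C f \<in> Obj C \<and> Tgt C f \<in> Obj C) \<and>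
     (\<forall>A\<in>Obj C. Ide C A \<in> Hom C A A) \<and>
     (\<forall>A\<in>Obj C. \<forall>B\<in>Obj C. \<forall>D\<in>Obj C. \<forall>f\<in>Hom C A B. \<forall>g\<in>Hom C B D. g \<star>\<^bsub>C\<^esub> f \<in> Hom C A D) \<and>
     (\<forall>A\<in>Obj C. \<forall>B\<in>Obj C. \<forall>f\<in>Hom C A B. f \<star>\<^bsub>C\<^esub> Ide C A = f \<and> Ide C B \<star>\<^bsub>C\<^esub> f = f) \<and>
     (\<forall>f\<in>Arr C. \<forall>g\<in>Arr C. \<forall>h\<in>Arr C. Tgt C f = Src C g \<longrightarrow> Tgt C g = Src C h \<longrightarrow>
        h \<star>\<^bsub>C\<^esub> (g \<star>\<^bsub>C\<^esub> f) = (h \<star>\<^bsub>C\<^esub> g) \<star>\<^bsub>C\<^esub> f)"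

definition inverse_arrows :: "('o, 'a, 'z) monoidal_cat_scheme \<Rightarrow> 'a \<Rightarrow> 'a \<Rightarrow> bool" where
  "inverse_arrows C f g \<longleftrightarrow> f \<in> Arr C \<and> g \<in> Hom C (Tgt C f) (Src C f) \<and>
     g \<star>\<^bsub>C\<^esub> f = Ide C (Src C f) \<and> f \<star>\<^bsub>C\<^esub> g = Ide C (Tgt C f)"

definition Iso :: "('o, 'a, 'z) monoidal_cat_scheme \<Rightarrow> 'o \<Rightarrow> 'o \<Rightarrow> 'a set" where
  "Iso C A B = {f \<in> Hom C A B. \<exists>g. inverse_arrows C f g}"

definition inv_arr :: "('o, 'a, 'z) monoidal_cat_scheme \<Rightarrow> 'a \<Rightarrow> 'a" where
  "inv_arr C f = (THE g. inverse_arrows C f g)"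

definition monoidal_category :: "('o, 'a, 'z) monoidal_cat_scheme \<Rightarrow> bool" where
  "monoidal_category C \<longleftrightarrow> category C \<and> Unt C \<in> Obj C \<and>
     (\<forall>A\<in>Obj C. \<forall>B\<in>Obj C. A \<boxdot>\<^bsub>C\<^esub> B \<in> Obj C \<and> Ide C A \<boxtimes>\<^bsub>C\<^esub> Ide C B = Ide C (A \<boxdot>\<^bsub>C\<^esub> B)) \<and>
     (\<forall>f\<in>Arr C. \<forall>g\<in>Arr C. f \<boxtimes>\<^bsub>C\<^esub> g \<in> Hom C (Src C f \<boxdot>\<^bsub>C\<^esub> Src C g) (Tgt C f \<boxdot>\<^bsub>C\<^esub> Tgt C g)) \<and>
     (\<forall>f\<in>Arr C. \<forall>f'\<in>Arr C. \<forall>g\<in>Arr C. \<forall>g'\<in>Arr C. Tgt C f = Src C f' \<longrightarrow> Tgt C g = Src C g' \<longrightarrow>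
        (f' \<star>\<^bsub>C\<^esub> f) \<boxtimes>\<^bsub>C\<^esub> (g' \<star>\<^bsub>C\<^esub> g) = (f' \<boxtimes>\<^bsub>C\<^esub> g') \<star>\<^bsub>C\<^esub> (f \<boxtimes>\<^bsub>C\<^esub> g)) \<and>
     (\<forall>A\<in>Obj C. \<forall>B\<in>Obj C. \<forall>D\<in>Obj C.
        Asc C A B D \<in> Iso C ((A \<boxdot>\<^bsub>C\<^esub> B) \<boxdot>\<^bsub>C\<^esub> D) (A \<boxdot>\<^bsub>C\<^esub> (B \<boxdot>\<^bsub>C\<^esub> D))) \<and>
     (\<forall>A\<in>Obj C. LUn C A \<in> Iso C (Unt C \<boxdot>\<^bsub>C\<^esub> A) A \<and> RUn C A \<in> Iso C (A \<boxdot>\<^bsub>C\<^esub> Unt C) A) \<and>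
     (\<forall>f\<in>Arr C. \<forall>g\<in>Arr C. \<forall>h\<in>Arr C.
        Asc C (Tgt C f) (Tgt C g) (Tgt C h) \<star>\<^bsub>C\<^esub> ((f \<boxtimes>\<^bsub>C\<^esub> g) \<boxtimes>\<^bsub>C\<^esub> h) =
        (f \<boxtimes>\<^bsub>C\<^esub> (g \<boxtimes>\<^bsub>C\<^esub> h)) \<star>\<^bsub>C\<^esub> Asc C (Src C f) (Src C g) (Src C h)) \<and>
     (\<forall>f\<in>Arr C. LUn C (Tgt C f) \<star>\<^bsub>C\<^esub> (Ide C (Unt C) \<boxtimes>\<^bsub>C\<^esub> f) = f \<star>\<^bsub>C\<^esub> LUn C (Src C f) \<and>
        RUn C (Tgt C f) \<star>\<^bsub>C\<^esub> (f \<boxtimes>\<^bsub>C\<^esub> Ide C (Unt C)) = f \<star>\<^bsub>C\<^esub> RUn C (Src C f)) \<and>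
     (\<forall>A\<in>Obj C. \<forall>B\<in>Obj C. \<forall>D\<in>Obj C. \<forall>E\<in>Obj C.
        Asc C A B (D \<boxdot>\<^bsub>C\<^esub> E) \<star>\<^bsub>C\<^esub> Asc C (A \<boxdot>\<^bsub>C\<^esub> B) D E =
        (Ide C A \<boxtimes>\<^bsub>C\<^esub> Asc C B D E) \<star>\<^bsub>C\<^esub> Asc C A (B \<boxdot>\<^bsub>C\<^esub> D) E \<star>\<^bsub>C\<^esub> (Asc C A B D \<boxtimes>\<^bsub>C\<^esub> Ide C E)) \<and>
     (\<forall>A\<in>Obj C. \<forall>B\<in>Obj C.
        (Ide C A \<boxtimes>\<^bsub>C\<^esub> LUn C B) \<star>\<^bsub>C\<^esub> Asc C A (Unt C) B = RUn C A \<boxtimes>\<^bsub>C\<^esub> Ide C B)"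

definition strict_monoidal_functor ::
  "('o, 'a, 'y) monoidal_cat_scheme \<Rightarrow> ('p, 'b, 'z) monoidal_cat_scheme \<Rightarrow>
   ('o \<Rightarrow> 'p) \<Rightarrow> ('a \<Rightarrow> 'b) \<Rightarrow> bool" where
  "strict_monoidal_functor C D Fo Fa \<longleftrightarrow>
     (\<forall>A\<in>Obj C. Fo A \<in> Obj D \<and> Fa (Ide C A) = Ide D (Fo A)) \<and>
     (\<forall>f\<in>Arr C. Fa f \<in> Hom D (Fo (Src C f)) (Fo (Tgt C f))) \<and>
     (\<forall>f\<in>Arr C. \<forall>g\<in>Arr C. Tgt C f = Src C g \<longrightarrow> Fa (g \<star>\<^bsub>C\<^esub> f) = Fa g \<star>\<^bsub>D\<^esub> Fa f) \<and>
     Fo (Unt C) = Unt D \<and>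
     (\<forall>A\<in>Obj C. \<forall>B\<in>Obj C. Fo (A \<boxdot>\<^bsub>C\<^esub> B) = Fo A \<boxdot>\<^bsub>D\<^esub> Fo B) \<and>
     (\<forall>f\<in>Arr C. \<forall>g\<in>Arr C. Fa (f \<boxtimes>\<^bsub>C\<^esub> g) = Fa f \<boxtimes>\<^bsub>D\<^esub> Fa g) \<and>
     (\<forall>A\<in>Obj C. \<forall>B\<in>Obj C. \<forall>E\<in>Obj C. Fa (Asc C A B E) = Asc D (Fo A) (Fo B) (Fo E)) \<and>
     (\<forall>A\<in>Obj C. Fa (LUn C A) = LUn D (Fo A) \<and> Fa (RUn C A) = RUn D (Fo A))"

record ('o, 'a, 'r) linear_cat = "('o, 'a) monoidal_cat" +
  Zer :: "'o \<Rightarrow> 'o \<Rightarrow> 'a"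
  Pls :: "'a \<Rightarrow> 'a \<Rightarrow> 'a"
  Scl :: "'r \<Rightarrow> 'a \<Rightarrow> 'a"

text \<open>The fields \<open>mult\<close> and \<open>one\<close> of a module record play no role in the notion of a module.\<close>

definition hom_module :: "('o, 'a, 'r, 'z) linear_cat_scheme \<Rightarrow> 'o \<Rightarrow> 'o \<Rightarrow> ('r, 'a) module" where
  "hom_module C A B = \<lparr>partial_object.carrier = Hom C A B, monoid.mult = undefined, monoid.one = undefined,
     ring.zero = Zer C A B, ring.add = Pls C, module.smult = Scl C\<rparr>"

definition linear_monoidal_category ::
  "('r, 'w) ring_scheme \<Rightarrow> ('o, 'a, 'r, 'z) linear_cat_scheme \<Rightarrow> bool" where
  "linear_monoidal_category R C \<longleftrightarrow> monoidal_category C \<and>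
     (\<forall>A\<in>Obj C. \<forall>B\<in>Obj C. Module.module R (hom_module C A B)) \<and>
     (\<forall>A\<in>Obj C. \<forall>B\<in>Obj C. \<forall>D\<in>Obj C. \<forall>f\<in>Hom C A B. \<forall>g\<in>Hom C B D.
        (\<forall>f'\<in>Hom C A B. g \<star>\<^bsub>C\<^esub> Pls C f f' = Pls C (g \<star>\<^bsub>C\<^esub> f) (g \<star>\<^bsub>C\<^esub> f')) \<and>
        (\<forall>g'\<in>Hom C B D. Pls C g g' \<star>\<^bsub>C\<^esub> f = Pls C (g \<star>\<^bsub>C\<^esub> f) (g' \<star>\<^bsub>C\<^esub> f)) \<and>
        (\<forall>r\<in>carrier R. Scl C r g \<star>\<^bsub>C\<^esub> f = Scl C r (g \<star>\<^bsub>C\<^esub> f) \<and>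
                       g \<star>\<^bsub>C\<^esub> Scl C r f = Scl C r (g \<star>\<^bsub>C\<^esub> f))) \<and>
     (\<forall>A\<in>Obj C. \<forall>B\<in>Obj C. \<forall>D\<in>Obj C. \<forall>E\<in>Obj C. \<forall>f\<in>Hom C A B. \<forall>g\<in>Hom C D E.
        (\<forall>f'\<in>Hom C A B. Pls C f f' \<boxtimes>\<^bsub>C\<^esub> g = Pls C (f \<boxtimes>\<^bsub>C\<^esub> g) (f' \<boxtimes>\<^bsub>C\<^esub> g)) \<and>
        (\<forall>g'\<in>Hom C D E. f \<boxtimes>\<^bsub>C\<^esub> Pls C g g' = Pls C (f \<boxtimes>\<^bsub>C\<^esub> g) (f \<boxtimes>\<^bsub>C\<^esub> g')) \<and>
        (\<forall>r\<in>carrier R. Scl C r f \<boxtimes>\<^bsub>C\<^esub> g = Scl C r (f \<boxtimes>\<^bsub>C\<^esub> g) \<and>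
                       f \<boxtimes>\<^bsub>C\<^esub> Scl C r g = Scl C r (f \<boxtimes>\<^bsub>C\<^esub> g)))"

definition linear_map ::
  "('r, 'w) ring_scheme \<Rightarrow> ('r, 'm) module \<Rightarrow> ('r, 'n) module \<Rightarrow> ('m \<Rightarrow> 'n) \<Rightarrow> bool" where
  "linear_map R M N f \<longleftrightarrow> f \<in> carrier M \<rightarrow> carrier N \<and>
     (\<forall>x\<in>carrier M. \<forall>y\<in>carrier M. f (x \<oplus>\<^bsub>M\<^esub> y) = f x \<oplus>\<^bsub>N\<^esub> f y) \<and>
     (\<forall>r\<in>carrier R. \<forall>x\<in>carrier M. f (r \<odot>\<^bsub>M\<^esub> x) = r \<odot>\<^bsub>N\<^esub> f x)"

text \<open>Underlying modules and underlying linear maps.  \<open>UOne\<close> identifies the ring, as a module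
  over itself, with the module underlying the tensor unit.\<close>

record ('o, 'a, 'r, 'e) underlying =
  UObj :: "'o \<Rightarrow> ('r, 'e) module"
  UMap :: "'a \<Rightarrow> 'e \<Rightarrow> 'e"
  UOne :: "'r \<Rightarrow> 'e"

definition category_of_modules ::
  "('r, 'w) ring_scheme \<Rightarrow> ('o, 'a, 'r, 'z) linear_cat_scheme \<Rightarrow> ('o, 'a, 'r, 'e) underlying \<Rightarrow> bool" where
  "category_of_modules R C U \<longleftrightarrow>
     (\<forall>A\<in>Obj C. Module.module R (UObj U A)) \<and>
     (\<forall>A\<in>Obj C. \<forall>B\<in>Obj C. \<forall>f\<in>Hom C A B. linear_map R (UObj U A) (UObj U B) (UMap U f)) \<and>
     (\<forall>A\<in>Obj C. \<forall>x\<in>carrier (UObj U A). UMap U (Ide C A) x = x) \<and>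
     (\<forall>f\<in>Arr C. \<forall>g\<in>Arr C. Tgt C f = Src C g \<longrightarrow>
        (\<forall>x\<in>carrier (UObj U (Src C f)). UMap U (g \<star>\<^bsub>C\<^esub> f) x = UMap U g (UMap U f x))) \<and>
     (\<forall>A\<in>Obj C. \<forall>B\<in>Obj C. \<forall>f\<in>Hom C A B. \<forall>x\<in>carrier (UObj U A).
        (\<forall>g\<in>Hom C A B. UMap U (Pls C f g) x = UMap U f x \<oplus>\<^bsub>UObj U B\<^esub> UMap U g x) \<and>
        (\<forall>r\<in>carrier R. UMap U (Scl C r f) x = r \<odot>\<^bsub>UObj U B\<^esub> UMap U f x)) \<and>
     (\<forall>A\<in>Obj C. \<forall>B\<in>Obj C. \<forall>f\<in>Hom C A B. \<forall>g\<in>Hom C A B.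
        (\<forall>x\<in>carrier (UObj U A). UMap U f x = UMap U g x) \<longrightarrow> f = g)"

definition tensor_unit_is_ring ::
  "('r, 'w) ring_scheme \<Rightarrow> ('o, 'a, 'r, 'z) linear_cat_scheme \<Rightarrow> ('o, 'a, 'r, 'e) underlying \<Rightarrow> bool" where
  "tensor_unit_is_ring R C U \<longleftrightarrow>
     bij_betw (UOne U) (carrier R) (carrier (UObj U (Unt C))) \<and>
     (\<forall>r\<in>carrier R. \<forall>s\<in>carrier R.
        UOne U (r \<oplus>\<^bsub>R\<^esub> s) = UOne U r \<oplus>\<^bsub>UObj U (Unt C)\<^esub> UOne U s \<and>
        UOne U (r \<otimes>\<^bsub>R\<^esub> s) = r \<odot>\<^bsub>UObj U (Unt C)\<^esub> UOne U s)"

definition unit_endos_scalar ::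
  "('r, 'w) ring_scheme \<Rightarrow> ('o, 'a, 'r, 'z) linear_cat_scheme \<Rightarrow> bool" where
  "unit_endos_scalar R C \<longleftrightarrow>
     (\<forall>f\<in>Hom C (Unt C) (Unt C). \<exists>r\<in>carrier R. f = Scl C r (Ide C (Unt C)))"

section \<open>Coefficient extension\<close>

text \<open>\<open>R1 \<otimes>\<^bsub>R0,\<sigma>\<^esub> M\<close> is the free abelian group on \<open>carrier R1 \<times> carrier M\<close> modulo
  biadditivity and \<open>(r \<cdot> \<sigma> a) \<otimes> m = r \<otimes> (a \<cdot> m)\<close>; its elements are cosets of the
  group of relations.\<close>

definition ext_free :: "('r1, 'w) ring_scheme \<Rightarrow> ('r0, 'm) module \<Rightarrow> ('r1 \<times> 'm \<Rightarrow>\<^sub>0 int) monoid" where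
  "ext_free R1 M = free_Abelian_group (carrier R1 \<times> carrier M)"

definition ext_relations ::
  "('r0 \<Rightarrow> 'r1) \<Rightarrow> ('r0, 'v) ring_scheme \<Rightarrow> ('r1, 'w) ring_scheme \<Rightarrow> ('r0, 'm) module \<Rightarrow>
   ('r1 \<times> 'm \<Rightarrow>\<^sub>0 int) set" where
  "ext_relations \<sigma> R0 R1 M = generate (ext_free R1 M)
     ({frag_of (r \<oplus>\<^bsub>R1\<^esub> s, m) - frag_of (r, m) - frag_of (s, m) | r s m.
         r \<in> carrier R1 \<and> s \<in> carrier R1 \<and> m \<in> carrier M} \<union>
      {frag_of (r, m \<oplus>\<^bsub>M\<^esub> n) - frag_of (r, m) - frag_of (r, n) | r m n.
         r \<in> carrier R1 \<and> m \<in> carrier M \<and> n \<in> carrier M} \<union>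
      {frag_of (r \<otimes>\<^bsub>R1\<^esub> \<sigma> a, m) - frag_of (r, a \<odot>\<^bsub>M\<^esub> m) | r a m.
         r \<in> carrier R1 \<and> a \<in> carrier R0 \<and> m \<in> carrier M})"

definition ext_class ::
  "('r0 \<Rightarrow> 'r1) \<Rightarrow> ('r0, 'v) ring_scheme \<Rightarrow> ('r1, 'w) ring_scheme \<Rightarrow> ('r0, 'm) module \<Rightarrow>
   ('r1 \<times> 'm \<Rightarrow>\<^sub>0 int) \<Rightarrow> ('r1 \<times> 'm \<Rightarrow>\<^sub>0 int) set" where
  "ext_class \<sigma> R0 R1 M x = ext_relations \<sigma> R0 R1 M #>\<^bsub>ext_free R1 M\<^esub> x"

definition pure_tensor ::
  "('r0 \<Rightarrow> 'r1) \<Rightarrow> ('r0, 'v) ring_scheme \<Rightarrow> ('r1, 'w) ring_scheme \<Rightarrow> ('r0, 'm) module \<Rightarrow>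
   'r1 \<Rightarrow> 'm \<Rightarrow> ('r1 \<times> 'm \<Rightarrow>\<^sub>0 int) set" where
  "pure_tensor \<sigma> R0 R1 M r m = ext_class \<sigma> R0 R1 M (frag_of (r, m))"

text \<open>In \<open>ext_module\<close> and \<open>ext_map\<close> the union over the representatives \<open>x\<close> of a coset is a
  union of equal sets.\<close>

definition ext_module ::
  "('r0 \<Rightarrow> 'r1) \<Rightarrow> ('r0, 'v) ring_scheme \<Rightarrow> ('r1, 'w) ring_scheme \<Rightarrow> ('r0, 'm) module \<Rightarrow>
   ('r1, ('r1 \<times> 'm \<Rightarrow>\<^sub>0 int) set) module" where
  "ext_module \<sigma> R0 R1 M =
     \<lparr>partial_object.carrier = rcosets\<^bsub>ext_free R1 M\<^esub> (ext_relations \<sigma> R0 R1 M),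
      monoid.mult = undefined, monoid.one = undefined,
      ring.zero = ext_relations \<sigma> R0 R1 M,
      ring.add = (\<lambda>X Y. X <#>\<^bsub>ext_free R1 M\<^esub> Y),
      module.smult = (\<lambda>s X. \<Union>x\<in>X. ext_class \<sigma> R0 R1 M
                 (frag_extend (\<lambda>(r, m). frag_of (s \<otimes>\<^bsub>R1\<^esub> r, m)) x))\<rparr>"

text \<open>\<open>id \<otimes> f\<close>, for \<open>f\<close> from the module \<open>M\<close> to the module \<open>N\<close>.\<close>

definition ext_map ::
  "('r0 \<Rightarrow> 'r1) \<Rightarrow> ('r0, 'v) ring_scheme \<Rightarrow> ('r1, 'w) ring_scheme \<Rightarrow> ('r0, 'n) module \<Rightarrow>
   ('m \<Rightarrow> 'n) \<Rightarrow> ('r1 \<times> 'm \<Rightarrow>\<^sub>0 int) set \<Rightarrow> ('r1 \<times> 'n \<Rightarrow>\<^sub>0 int) set" where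
  "ext_map \<sigma> R0 R1 N f X =
     (\<Union>x\<in>X. ext_class \<sigma> R0 R1 N (frag_extend (\<lambda>(r, m). frag_of (r, f m)) x))"

section \<open>Realization in a common category\<close>

text \<open>The objects \<open>obs\<close> and morphisms \<open>arrs\<close> of \<open>C\<close> are objects and morphisms of \<open>D\<close>, with
  the same structure.\<close>

definition realized_in ::
  "('o, 'a, 'r) linear_cat \<Rightarrow> ('o, 'a, 'r) linear_cat \<Rightarrow> ('r, 'w) ring_scheme \<Rightarrow>
   'o set \<Rightarrow> 'a set \<Rightarrow> bool" where
  "realized_in C D R obs arrs \<longleftrightarrow> obs \<subseteq> Obj D \<and> arrs \<subseteq> Arr D \<and> Unt D = Unt C \<and>
     (\<forall>A\<in>obs. Ide D A = Ide C A \<and> LUn D A = LUn C A \<and> RUn D A = RUn C A) \<and>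
     (\<forall>A\<in>obs. \<forall>B\<in>obs. A \<boxdot>\<^bsub>D\<^esub> B = A \<boxdot>\<^bsub>C\<^esub> B) \<and>
     (\<forall>A\<in>obs. \<forall>B\<in>obs. \<forall>E\<in>obs. Asc D A B E = Asc C A B E) \<and>
     (\<forall>f\<in>arrs. Src D f = Src C f \<and> Tgt D f = Tgt C f \<and>
        (\<forall>r\<in>carrier R. Scl D r f = Scl C r f) \<and>
        (\<forall>g\<in>arrs. f \<boxtimes>\<^bsub>D\<^esub> g = f \<boxtimes>\<^bsub>C\<^esub> g \<and>
           (Tgt C f = Src C g \<longrightarrow> g \<star>\<^bsub>D\<^esub> f = g \<star>\<^bsub>C\<^esub> f) \<and>
           (Src C f = Src C g \<longrightarrow> Tgt C f = Tgt C g \<longrightarrow> Pls D f g = Pls C f g)))"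

text \<open>\<open>So A\<close> and \<open>Sa f\<close> are \<open>\<sigma>\<^sub>* A\<close> and \<open>\<sigma>\<^sub>* f\<close> as an object and a morphism of \<open>D\<close>.  A scalar
  extension is only given up to canonical isomorphism, so \<open>\<theta> A\<close> identifies the tensor product
  \<open>R1 \<otimes> UObj U0 A\<close> with the module underlying \<open>So A\<close>.  The final
  conditions identify \<open>\<sigma>\<^sub>* R0\<close> with \<open>R1\<close> by \<open>r \<otimes> a \<mapsto> r \<cdot> \<sigma> a\<close>.\<close>

definition extension_realized_in ::
  "('r0 \<Rightarrow> 'r1) \<Rightarrow> ('r0, 'v) ring_scheme \<Rightarrow> ('r1, 'w) ring_scheme \<Rightarrow>
   ('o0, 'a0, 'r0) linear_cat \<Rightarrow> ('o0, 'a0, 'r0, 'e0) underlying \<Rightarrow>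
   ('o1, 'a1, 'r1) linear_cat \<Rightarrow> ('o1, 'a1, 'r1, 'e1) underlying \<Rightarrow>
   'o0 set \<Rightarrow> 'a0 set \<Rightarrow>
   ('o0 \<Rightarrow> 'o1) \<Rightarrow> ('a0 \<Rightarrow> 'a1) \<Rightarrow> ('o0 \<Rightarrow> ('r1 \<times> 'e0 \<Rightarrow>\<^sub>0 int) set \<Rightarrow> 'e1) \<Rightarrow> bool" where
  "extension_realized_in \<sigma> R0 R1 C U0 D U1 obs arrs So Sa \<theta> \<longleftrightarrow>
     (\<forall>A\<in>obs. So A \<in> Obj D \<and>
        linear_map R1 (ext_module \<sigma> R0 R1 (UObj U0 A)) (UObj U1 (So A)) (\<theta> A) \<and>
        bij_betw (\<theta> A) (carrier (ext_module \<sigma> R0 R1 (UObj U0 A))) (carrier (UObj U1 (So A)))) \<and>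
     (\<forall>f\<in>arrs. Sa f \<in> Hom D (So (Src C f)) (So (Tgt C f)) \<and>
        (\<forall>t\<in>carrier (ext_module \<sigma> R0 R1 (UObj U0 (Src C f))).
           UMap U1 (Sa f) (\<theta> (Src C f) t) =
           \<theta> (Tgt C f) (ext_map \<sigma> R0 R1 (UObj U0 (Tgt C f)) (UMap U0 f) t))) \<and>
     So (Unt C) = Unt D \<and>
     (\<forall>r\<in>carrier R1. \<forall>a\<in>carrier R0.
        \<theta> (Unt C) (pure_tensor \<sigma> R0 R1 (UObj U0 (Unt C)) r (UOne U0 a)) = UOne U1 (r \<otimes>\<^bsub>R1\<^esub> \<sigma> a))"

section \<open>Oriented tangles\<close>

datatype sign = Plus | Minus

type_synonym point = "real \<times> real \<times> real"

text \<open>The third coordinate is the height.  A polygonal oriented tangle is given by its finite set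
  of oriented edges \<open>(p, q)\<close>.\<close>

type_synonym polygon = "(point \<times> point) set"

definition height :: "point \<Rightarrow> real" where
  "height p = snd (snd p)"

definition slab :: "point set" where
  "slab = {p. 0 \<le> height p \<and> height p \<le> 1}"

definition slab_boundary :: "point set" where
  "slab_boundary = {p. height p = 0 \<or> height p = 1}"

definition ends :: "sign \<Rightarrow> sign list \<Rightarrow> real \<Rightarrow> point set" where
  "ends s X z = {(real (i + 1), 0, z) | i. i < length X \<and> X ! i = s}"

definition support :: "polygon \<Rightarrow> point set" where
  "support T = (\<Union>(p, q)\<in>T. closed_segment p q)"

text \<open>Injectivity of \<open>fst\<close> and \<open>snd\<close> says that at most one edge leaves and at most one edge enters
  each vertex.  The remaining points \<open>fst ` T \<inter> snd ` T\<close> are the interior vertices.\<close>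

definition tangles :: "sign list \<Rightarrow> sign list \<Rightarrow> polygon set" where
  "tangles X Y = {T. finite T \<and>
     (\<forall>(p, q)\<in>T. p \<noteq> q \<and> p \<in> slab \<and> q \<in> slab \<and> open_segment p q \<subseteq> slab - slab_boundary) \<and>
     (\<forall>(p, q)\<in>T. \<forall>(p', q')\<in>T. (p, q) \<noteq> (p', q') \<longrightarrow>
        closed_segment p q \<inter> closed_segment p' q' \<subseteq> {p, q} \<inter> {p', q'}) \<and>
     inj_on fst T \<and> inj_on snd T \<and>
     fst ` T \<inter> snd ` T \<subseteq> slab - slab_boundary \<and>
     fst ` T - snd ` T = ends Plus X 0 \<union> ends Minus Y 1 \<and>
     snd ` T - fst ` T = ends Minus X 0 \<union> ends Plus Y 1}"

definition subdivides :: "polygon \<Rightarrow> polygon \<Rightarrow> bool" where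
  "subdivides T T' \<longleftrightarrow> support T' = support T \<and>
     (\<forall>(p, q)\<in>T'. \<exists>(a, b)\<in>T. \<exists>s t. 0 \<le> s \<and> s < t \<and> t \<le> 1 \<and> p = linepath a b s \<and> q = linepath a b t)"

text \<open>A compactly supported isotopy of the slab that fixes the boundary pointwise.\<close>

definition ambient_isotopy :: "(real \<times> point \<Rightarrow> point) \<Rightarrow> bool" where
  "ambient_isotopy H \<longleftrightarrow> continuous_on ({0..1} \<times> slab) H \<and>
     (\<forall>t\<in>{0..1}. \<exists>G. homeomorphism slab slab (\<lambda>p. H (t, p)) G) \<and>
     (\<forall>p\<in>slab. H (0, p) = p) \<and>
     (\<forall>t\<in>{0..1}. \<forall>p\<in>slab_boundary. H (t, p) = p) \<and>
     (\<exists>K. compact K \<and> (\<forall>t\<in>{0..1}. \<forall>p\<in>slab - K. H (t, p) = p))"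

definition carries :: "(real \<times> point \<Rightarrow> point) \<Rightarrow> polygon \<Rightarrow> polygon \<Rightarrow> bool" where
  "carries H T T' \<longleftrightarrow> T' = (\<lambda>(p, q). (H (1, p), H (1, q))) ` T \<and>
     (\<forall>(p, q)\<in>T. (\<lambda>x. H (1, x)) ` closed_segment p q = closed_segment (H (1, p)) (H (1, q)))"

text \<open>If the end of an ambient isotopy maps one oriented polygonal tangle onto another, respecting
  orientations, then it carries edges to edges for suitable subdivisions of both.  So the
  equivalence relation generated below is isotopy rel boundary of oriented tangles.\<close>

definition tangle_move :: "sign list \<Rightarrow> sign list \<Rightarrow> polygon \<Rightarrow> polygon \<Rightarrow> bool" where
  "tangle_move X Y T T' \<longleftrightarrow> T \<in> tangles X Y \<and> T' \<in> tangles X Y \<and>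
     (subdivides T T' \<or> (\<exists>H. ambient_isotopy H \<and> carries H T T'))"

definition isotopic :: "sign list \<Rightarrow> sign list \<Rightarrow> polygon \<Rightarrow> polygon \<Rightarrow> bool" where
  "isotopic X Y = equivclp (tangle_move X Y)"

type_synonym tangle_class = "sign list \<times> polygon set \<times> sign list"

definition tangle_class :: "sign list \<Rightarrow> sign list \<Rightarrow> polygon \<Rightarrow> tangle_class" where
  "tangle_class X Y T = (X, {T'. isotopic X Y T T'}, Y)"

definition map_polygon :: "(point \<Rightarrow> point) \<Rightarrow> polygon \<Rightarrow> polygon" where
  "map_polygon f T = (\<lambda>(p, q). (f p, f q)) ` T"

definition stack :: "polygon \<Rightarrow> polygon \<Rightarrow> polygon" where
  "stack T S = map_polygon (\<lambda>(x, y, z). (x, y, z / 2)) S \<union>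
               map_polygon (\<lambda>(x, y, z). (x, y, (z + 1) / 2)) T"

text \<open>Juxtaposition of \<open>T\<close>, with \<open>n\<close> bottom and \<open>m\<close> top endpoints, and \<open>S\<close>.  The second factor
  is moved to the right by a shear, because the shift is \<open>n\<close> at the bottom and \<open>m\<close> at the top.  Only
  representatives are used for which \<open>S\<close> lies strictly to the right of the wall \<open>x = 1/2\<close> and
  \<open>T\<close> strictly to the left of its sheared image.\<close>

definition shear :: "nat \<Rightarrow> nat \<Rightarrow> point \<Rightarrow> point" where
  "shear n m = (\<lambda>(x, y, z). (x + real n + (real m - real n) * z, y, z))"

definition left_of_wall :: "nat \<Rightarrow> nat \<Rightarrow> polygon \<Rightarrow> bool" where
  "left_of_wall n m T \<longleftrightarrow>
     (\<forall>(x, y, z)\<in>support T. x < 1 / 2 + real n + (real m - real n) * z)"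

definition right_of_wall :: "polygon \<Rightarrow> bool" where
  "right_of_wall S \<longleftrightarrow> (\<forall>(x, y, z)\<in>support S. 1 / 2 < x)"

definition identity_tangle :: "sign list \<Rightarrow> polygon" where
  "identity_tangle X =
     {((real (i + 1), 0, 0), (real (i + 1), 0, 1)) | i. i < length X \<and> X ! i = Plus} \<union>
     {((real (i + 1), 0, 1), (real (i + 1), 0, 0)) | i. i < length X \<and> X ! i = Minus}"

definition OTa_comp :: "tangle_class \<Rightarrow> tangle_class \<Rightarrow> tangle_class" where
  "OTa_comp = (\<lambda>(Y', d, Z) (X, c, Y).
     (X, {R. \<exists>T\<in>d. \<exists>S\<in>c. isotopic X Z (stack T S) R}, Z))"

definition OTa_tensor :: "tangle_class \<Rightarrow> tangle_class \<Rightarrow> tangle_class" where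
  "OTa_tensor = (\<lambda>(X, c, Y) (X', d, Y').
     (X @ X',
      {R. \<exists>T\<in>c. \<exists>S\<in>d. left_of_wall (length X) (length Y) T \<and> right_of_wall S \<and>
            isotopic (X @ X') (Y @ Y') (T \<union> map_polygon (shear (length X) (length Y)) S) R},
      Y @ Y'))"

definition OTa :: "(sign list, tangle_class) monoidal_cat" where
  "OTa = \<lparr>Obj = UNIV,
     Arr = {tangle_class X Y T | X Y T. T \<in> tangles X Y},
     Src = (\<lambda>(X, c, Y). X),
     Tgt = (\<lambda>(X, c, Y). Y),
     Ide = (\<lambda>X. tangle_class X X (identity_tangle X)),
     Cmp = OTa_comp,
     Unt = [],
     TObj = (@),
     TArr = OTa_tensor,
     Asc = (\<lambda>X Y Z. tangle_class (X @ Y @ Z) (X @ Y @ Z) (identity_tangle (X @ Y @ Z))),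
     LUn = (\<lambda>X. tangle_class X X (identity_tangle X)),
     RUn = (\<lambda>X. tangle_class X X (identity_tangle X))\<rparr>"

text \<open>In diagrams \<open>x\<close> points to the right, the height upwards and \<open>y\<close> away from the viewer, which
  is a right-handed frame.  In a crossing the strand from bottom left to top right bends to
  \<open>y = -1\<close>, over the other one, for the positive crossing, and to \<open>y = 1\<close> for the negative one.\<close>

definition crossing :: "real \<Rightarrow> polygon" where
  "crossing y = {((1, 0, 0), (3/2, y, 1/2)), ((3/2, y, 1/2), (2, 0, 1)), ((2, 0, 0), (1, 0, 1))}"

definition arc :: "point \<Rightarrow> point \<Rightarrow> polygon" where
  "arc p q = {(p, (3/2, 0, 1/2)), ((3/2, 0, 1/2), q)}"

definition generators :: "tangle_class set" where
  "generators =
     {tangle_class [Plus, Plus] [Plus, Plus] (crossing (-1)),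
      tangle_class [Plus, Plus] [Plus, Plus] (crossing 1),
      tangle_class [Minus, Plus] [] (arc (2, 0, 0) (1, 0, 0)),
      tangle_class [Plus, Minus] [] (arc (1, 0, 0) (2, 0, 0)),
      tangle_class [] [Minus, Plus] (arc (1, 0, 1) (2, 0, 1)),
      tangle_class [] [Plus, Minus] (arc (2, 0, 1) (1, 0, 1))}"

definition elementary_slice :: "tangle_class \<Rightarrow> bool" where
  "elementary_slice E \<longleftrightarrow> E \<in> Arr OTa \<and>
     (\<exists>U V. \<exists>G\<in>generators. E = (Ide OTa U \<boxtimes>\<^bsub>OTa\<^esub> G) \<boxtimes>\<^bsub>OTa\<^esub> Ide OTa V)"

section \<open>Defects\<close>

text \<open>\<open>decomposition [E\<^sub>k, \<dots>, E\<^sub>1] T\<close> means \<open>T = E\<^sub>k \<circ> \<dots> \<circ> E\<^sub>1\<close>, with elementary slices and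
  identities as layers.\<close>

definition layer :: "tangle_class \<Rightarrow> bool" where
  "layer E \<longleftrightarrow> elementary_slice E \<or> E \<in> range (Ide OTa)"

inductive decomposition :: "tangle_class list \<Rightarrow> tangle_class \<Rightarrow> bool" where
  single: "layer E \<Longrightarrow> decomposition [E] E"
| step: "decomposition Es T \<Longrightarrow> layer E \<Longrightarrow> Tgt OTa T = Src OTa E \<Longrightarrow>
         decomposition (E # Es) (E \<star>\<^bsub>OTa\<^esub> T)"

definition layer_defect :: "('r, 'w) ring_scheme \<Rightarrow> (tangle_class \<Rightarrow> 'r) \<Rightarrow> tangle_class \<Rightarrow> 'r" where
  "layer_defect R \<alpha> E = (if E \<in> range (Ide OTa) then \<one>\<^bsub>R\<^esub> else \<alpha> E)"

definition defect_product ::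
  "('r, 'w) ring_scheme \<Rightarrow> (tangle_class \<Rightarrow> 'r) \<Rightarrow> tangle_class list \<Rightarrow> 'r" where
  "defect_product R \<alpha> Es = foldr (\<lambda>E c. layer_defect R \<alpha> E \<otimes>\<^bsub>R\<^esub> c) Es \<one>\<^bsub>R\<^esub>"

definition defects_give_scalars :: "('r, 'w) ring_scheme \<Rightarrow> (tangle_class \<Rightarrow> 'r) \<Rightarrow> bool" where
  "defects_give_scalars R \<alpha> \<longleftrightarrow>
     (\<forall>T\<in>Arr OTa. \<exists>!c. \<exists>Es. decomposition Es T \<and> defect_product R \<alpha> Es = c)"

definition tangle_defect :: "('r, 'w) ring_scheme \<Rightarrow> (tangle_class \<Rightarrow> 'r) \<Rightarrow> tangle_class \<Rightarrow> 'r" where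
  "tangle_defect R \<alpha> T = (THE c. \<exists>Es. decomposition Es T \<and> defect_product R \<alpha> Es = c)"

section \<open>Closed invariants and boundary comparisons\<close>

definition closed_invariant ::
  "('r, 'w) ring_scheme \<Rightarrow> ('o, 'a, 'r, 'z) linear_cat_scheme \<Rightarrow> (tangle_class \<Rightarrow> 'a) \<Rightarrow>
   tangle_class \<Rightarrow> 'r" where
  "closed_invariant R C Fa L = (THE r. r \<in> carrier R \<and> Fa L = Scl C r (Ide C (Unt C)))"

text \<open>\<open>P X\<close> stands for \<open>\<sigma>\<^sub>* (F\<^sub>0 X)\<close>.  Besides the formula for \<open>B (X @ Y)\<close>, the two ways of
  building the three-factor comparison from \<open>J\<close> agree up to the associator of \<open>D\<close>.\<close>

definition coherent_comparison ::
  "('o, 'a, 'z) monoidal_cat_scheme \<Rightarrow> (sign list \<Rightarrow> 'o) \<Rightarrow>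
   (sign list \<Rightarrow> sign list \<Rightarrow> 'a) \<Rightarrow> (sign list \<Rightarrow> 'a) \<Rightarrow> bool" where
  "coherent_comparison D P J B \<longleftrightarrow>
     (\<forall>X Y. J X Y \<in> Iso D (P X \<boxdot>\<^bsub>D\<^esub> P Y) (P (X @ Y))) \<and>
     (\<forall>X Y. B (X @ Y) = J X Y \<star>\<^bsub>D\<^esub> (B X \<boxtimes>\<^bsub>D\<^esub> B Y)) \<and>
     (\<forall>X Y Z. J (X @ Y) Z \<star>\<^bsub>D\<^esub> (J X Y \<boxtimes>\<^bsub>D\<^esub> Ide D (P Z)) =
        J X (Y @ Z) \<star>\<^bsub>D\<^esub> (Ide D (P X) \<boxtimes>\<^bsub>D\<^esub> J Y Z) \<star>\<^bsub>D\<^esub> Asc D (P X) (P Y) (P Z))"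

text \<open>\<open>c \<cdot> B\<^sub>Y\<^sup>-\<^sup>1 \<circ> \<sigma>\<^sub>* (F\<^sub>0 T) \<circ> B\<^sub>X\<close> for \<open>T : X \<rightarrow> Y\<close>, where \<open>Pa T\<close> stands for \<open>\<sigma>\<^sub>* (F\<^sub>0 T)\<close>.\<close>

definition transported ::
  "('o, 'a, 'r, 'z) linear_cat_scheme \<Rightarrow> (sign list \<Rightarrow> 'a) \<Rightarrow> (tangle_class \<Rightarrow> 'a) \<Rightarrow>
   'r \<Rightarrow> tangle_class \<Rightarrow> 'a" where
  "transported D B Pa c T =
     Scl D c (inv_arr D (B (Tgt OTa T)) \<star>\<^bsub>D\<^esub> Pa T \<star>\<^bsub>D\<^esub> B (Src OTa T))"

end

theory Submission
  imports Defs
begin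

text \<open>The idea is telescoping.  Cut a tangle into layers \<open>T = E\<^sub>k \<circ> \<dots> \<circ> E\<^sub>1\<close>.  Both \<open>F\<^sub>1\<close> and
\<open>\<sigma>\<^sub>* \<circ> F\<^sub>0\<close> turn this into a composite in the common category, and for each layer the first is
\<open>\<alpha>(E\<^sub>i)\<close> times the conjugate of the second by the boundary comparisons.  In the composite the
comparison at every intermediate word meets its inverse and cancels (\<open>scaled_conjugates_comp\<close>),
the scalars multiply to \<open>\<alpha>(T)\<close>, and only the comparisons at the two ends survive
(\<open>transport_decomposition\<close>).

For a link both ends are the empty word, where the comparison is the identity.  The endomorphism
\<open>F\<^sub>0(L)\<close> of the tensor unit is multiplication by \<open>I\<^sub>0(L)\<close>, which coefficient extension turns into
multiplication by \<open>\<sigma>(I\<^sub>0(L))\<close> (\<open>ext_map_scalar\<close>).  Comparing scalars gives the formula for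
\<open>I\<^sub>1(L)\<close>; a scalar is determined by its action on the tensor unit because that unit is the ring
itself (\<open>Scl_Ide_Unt_inject\<close>).

Two facts used here require an argument.  The first is that \<open>\<sigma>\<^sub>* \<circ> F\<^sub>0\<close> respects composition;
it follows from functoriality of the tensor product with \<open>R1\<close>, because an arrow of a category of
modules is determined by its underlying map (\<open>Sa_comp\<close>).  The second is that the partial products
\<open>E\<^sub>i \<circ> \<dots> \<circ> E\<^sub>1\<close> are tangle classes again.  This is the geometric part: a stack of two tangles is
a tangle (\<open>stack_tangles\<close>), and its class depends only on the classes of the factors, since an
isotopy of one factor fixes the boundary of the slab and hence extends by the identity over the
other half (\<open>isotopic_stack\<close>).\<close>

section \<open>Arrows in a linear monoidal category\<close>

lemma HomD: "f \<in> Hom C A B \<Longrightarrow> f \<in> Arr C \<and> Src C f = A \<and> Tgt C f = B"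
  by (simp add: Hom_def)

lemma Hom_Obj: "\<lbrakk>category C; f \<in> Hom C A B\<rbrakk> \<Longrightarrow> A \<in> Obj C \<and> B \<in> Obj C"
  by (auto simp: Hom_def category_def)

lemma Hom_comp: "\<lbrakk>category C; f \<in> Hom C A B; g \<in> Hom C B E\<rbrakk> \<Longrightarrow> g \<star>\<^bsub>C\<^esub> f \<in> Hom C A E"
  using Hom_Obj[of C f A B] Hom_Obj[of C g B E] by (auto simp: category_def)

lemma comp_assoc:
  "\<lbrakk>category C; f \<in> Hom C A B; g \<in> Hom C B E; h \<in> Hom C E F\<rbrakk>
    \<Longrightarrow> (h \<star>\<^bsub>C\<^esub> g) \<star>\<^bsub>C\<^esub> f = h \<star>\<^bsub>C\<^esub> (g \<star>\<^bsub>C\<^esub> f)"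
  by (auto simp: category_def Hom_def)

lemma comp_Ide: "\<lbrakk>category C; f \<in> Hom C A B\<rbrakk> \<Longrightarrow> f \<star>\<^bsub>C\<^esub> Ide C A = f \<and> Ide C B \<star>\<^bsub>C\<^esub> f = f"
  using Hom_Obj[of C f A B] unfolding category_def by blast

lemma inverse_arrows_unique:
  assumes C: "category C" and g: "inverse_arrows C f g" and h: "inverse_arrows C f h"
  shows "g = h"
proof -
  let ?A = "Src C f" and ?B = "Tgt C f"
  have f: "f \<in> Hom C ?A ?B" and gH: "g \<in> Hom C ?B ?A" and hH: "h \<in> Hom C ?B ?A"
    using g h by (auto simp: inverse_arrows_def Hom_def)
  have "g = (h \<star>\<^bsub>C\<^esub> f) \<star>\<^bsub>C\<^esub> g"
    using h comp_Ide[OF C gH] by (simp add: inverse_arrows_def)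
  also have "\<dots> = h \<star>\<^bsub>C\<^esub> (f \<star>\<^bsub>C\<^esub> g)"
    by (rule comp_assoc[OF C gH f hH])
  also have "\<dots> = h"
    using g comp_Ide[OF C hH] by (simp add: inverse_arrows_def)
  finally show ?thesis .
qed

lemma inv_arr_inverse:
  assumes C: "category C" and f: "f \<in> Iso C A B"
  shows "inv_arr C f \<in> Hom C B A" "inv_arr C f \<star>\<^bsub>C\<^esub> f = Ide C A" "f \<star>\<^bsub>C\<^esub> inv_arr C f = Ide C B"
proof -
  obtain g where "inverse_arrows C f g"
    using f by (auto simp: Iso_def)
  then have "inverse_arrows C f (inv_arr C f)"
    unfolding inv_arr_def using inverse_arrows_unique[OF C] by (metis theI)
  then show "inv_arr C f \<in> Hom C B A" "inv_arr C f \<star>\<^bsub>C\<^esub> f = Ide C A"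
      "f \<star>\<^bsub>C\<^esub> inv_arr C f = Ide C B"
    using f by (auto simp: inverse_arrows_def Iso_def Hom_def)
qed

lemma inv_arr_Ide:
  assumes C: "category C" and A: "A \<in> Obj C"
  shows "inv_arr C (Ide C A) = Ide C A"
proof -
  have I: "Ide C A \<in> Hom C A A"
    using C A by (simp add: category_def)
  then have "inverse_arrows C (Ide C A) (Ide C A)"
    using comp_Ide[OF C I] by (simp add: inverse_arrows_def Hom_def)
  then show ?thesis
    unfolding inv_arr_def using inverse_arrows_unique[OF C] by blast
qed

lemma linear_category: "linear_monoidal_category R C \<Longrightarrow> category C"
  by (simp add: linear_monoidal_category_def monoidal_category_def)

lemma Unt_Obj: "linear_monoidal_category R C \<Longrightarrow> Unt C \<in> Obj C"
  by (simp add: linear_monoidal_category_def monoidal_category_def)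

lemma
  assumes C: "linear_monoidal_category R C" and f: "f \<in> Hom C A B" and r: "r \<in> carrier R"
  shows Scl_Hom: "Scl C r f \<in> Hom C A B"
    and Scl_one: "Scl C \<one>\<^bsub>R\<^esub> f = f"
    and Scl_Scl: "s \<in> carrier R \<Longrightarrow> Scl C s (Scl C r f) = Scl C (s \<otimes>\<^bsub>R\<^esub> r) f"
proof -
  have "Module.module R (hom_module C A B)"
    using C Hom_Obj[OF linear_category[OF C] f] by (simp add: linear_monoidal_category_def)
  then interpret M: Module.module R "hom_module C A B" .
  have [simp]: "carrier (hom_module C A B) = Hom C A B" "(\<odot>\<^bsub>hom_module C A B\<^esub>) = Scl C"
    by (simp_all add: hom_module_def)
  show "Scl C r f \<in> Hom C A B" "Scl C \<one>\<^bsub>R\<^esub> f = f"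
    using M.smult_closed[OF r, of f] M.smult_one[of f] f by simp_all
  show "Scl C s (Scl C r f) = Scl C (s \<otimes>\<^bsub>R\<^esub> r) f" if "s \<in> carrier R"
    using M.smult_assoc1[OF that r, of f] f by simp
qed

lemma Scl_comp:
  assumes C: "linear_monoidal_category R C" and f: "f \<in> Hom C A B" and g: "g \<in> Hom C B E"
    and r: "r \<in> carrier R"
  shows "Scl C r g \<star>\<^bsub>C\<^esub> f = Scl C r (g \<star>\<^bsub>C\<^esub> f)" "g \<star>\<^bsub>C\<^esub> Scl C r f = Scl C r (g \<star>\<^bsub>C\<^esub> f)"
proof -
  have "A \<in> Obj C" "B \<in> Obj C" "E \<in> Obj C"
    using Hom_Obj[OF linear_category[OF C]] f g by auto
  then show "Scl C r g \<star>\<^bsub>C\<^esub> f = Scl C r (g \<star>\<^bsub>C\<^esub> f)" "g \<star>\<^bsub>C\<^esub> Scl C r f = Scl C r (g \<star>\<^bsub>C\<^esub> f)"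
    using C f g r unfolding linear_monoidal_category_def by blast+
qed

text \<open>The inner \<open>v\<close> and its inverse cancel, and bilinearity collects the two scalars in front.  This is
the whole reason why scalar defects multiply when layers are composed.\<close>

lemma scaled_conjugates_comp:
  assumes C: "linear_monoidal_category R C"
    and u: "u \<in> Iso C A A'" and v: "v \<in> Iso C B B'" and w: "w \<in> Iso C E E'"
    and p: "p \<in> Hom C A' B'" and q: "q \<in> Hom C B' E'"
    and a: "a \<in> carrier R" and c: "c \<in> carrier R"
  shows "Scl C a (inv_arr C w \<star>\<^bsub>C\<^esub> q \<star>\<^bsub>C\<^esub> v) \<star>\<^bsub>C\<^esub> Scl C c (inv_arr C v \<star>\<^bsub>C\<^esub> p \<star>\<^bsub>C\<^esub> u) =
         Scl C (a \<otimes>\<^bsub>R\<^esub> c) (inv_arr C w \<star>\<^bsub>C\<^esub> (q \<star>\<^bsub>C\<^esub> p) \<star>\<^bsub>C\<^esub> u)"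
proof -
  note cat = linear_category[OF C]
  have uH: "u \<in> Hom C A A'" and vH: "v \<in> Hom C B B'"
    using u v by (auto simp: Iso_def)
  note vi = inv_arr_inverse[OF cat v] and wi = inv_arr_inverse[OF cat w]
  have pu: "p \<star>\<^bsub>C\<^esub> u \<in> Hom C A B'" and qv: "q \<star>\<^bsub>C\<^esub> v \<in> Hom C B E'"
    using Hom_comp[OF cat] uH vH p q by blast+
  have vpu: "inv_arr C v \<star>\<^bsub>C\<^esub> p \<star>\<^bsub>C\<^esub> u \<in> Hom C A B" and wqv: "inv_arr C w \<star>\<^bsub>C\<^esub> q \<star>\<^bsub>C\<^esub> v \<in> Hom C B E"
    using Hom_comp[OF cat] pu qv vi wi by blast+
  have "v \<star>\<^bsub>C\<^esub> (inv_arr C v \<star>\<^bsub>C\<^esub> p \<star>\<^bsub>C\<^esub> u) = (v \<star>\<^bsub>C\<^esub> inv_arr C v) \<star>\<^bsub>C\<^esub> (p \<star>\<^bsub>C\<^esub> u)"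
    by (rule comp_assoc[OF cat pu vi(1) vH, symmetric])
  also have "\<dots> = p \<star>\<^bsub>C\<^esub> u"
    using vi(3) comp_Ide[OF cat pu] by simp
  finally have cancel: "v \<star>\<^bsub>C\<^esub> (inv_arr C v \<star>\<^bsub>C\<^esub> p \<star>\<^bsub>C\<^esub> u) = p \<star>\<^bsub>C\<^esub> u" .
  have "(inv_arr C w \<star>\<^bsub>C\<^esub> q \<star>\<^bsub>C\<^esub> v) \<star>\<^bsub>C\<^esub> (inv_arr C v \<star>\<^bsub>C\<^esub> p \<star>\<^bsub>C\<^esub> u) =
        inv_arr C w \<star>\<^bsub>C\<^esub> (q \<star>\<^bsub>C\<^esub> p) \<star>\<^bsub>C\<^esub> u"
    using comp_assoc[OF cat vpu qv wi(1)] comp_assoc[OF cat vpu vH q] comp_assoc[OF cat uH p q]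
    by (simp add: cancel)
  then show ?thesis
    using Scl_comp(1)[OF C Scl_Hom[OF C vpu c] wqv a] Scl_comp(2)[OF C vpu wqv c]
      Scl_Scl[OF C Hom_comp[OF cat vpu wqv] c a] by simp
qed

text \<open>Equations between arrows will be verified on the elements of the underlying modules.\<close>

lemma category_of_modules_ext:
  assumes "category_of_modules R C U" "category C" "f \<in> Hom C A B" "g \<in> Hom C A B"
    and "\<And>x. x \<in> carrier (UObj U A) \<Longrightarrow> UMap U f x = UMap U g x"
  shows "f = g"
  using assms(1,3-5) Hom_Obj[OF assms(2,3)] unfolding category_of_modules_def by blast

lemma UMap_Scl_Ide:
  assumes C: "category_of_modules R C U" "category C" "A \<in> Obj C"
    and r: "r \<in> carrier R" and x: "x \<in> carrier (UObj U A)"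
  shows "UMap U (Scl C r (Ide C A)) x = r \<odot>\<^bsub>UObj U A\<^esub> x"
proof -
  have I: "Ide C A \<in> Hom C A A"
    using C(2,3) by (simp add: category_def)
  have "UMap U (Scl C r (Ide C A)) x = r \<odot>\<^bsub>UObj U A\<^esub> UMap U (Ide C A) x"
    using C(1,3) I r x unfolding category_of_modules_def by blast
  moreover have "UMap U (Ide C A) x = x"
    using C(1,3) x unfolding category_of_modules_def by blast
  ultimately show ?thesis by simp
qed

text \<open>Evaluating \<open>r \<cdot> id\<close> at the element \<open>1\<close> of the tensor unit recovers \<open>r\<close>.  Hence a closed
invariant is a well-defined scalar.\<close>

lemma Scl_Ide_Unt_inject:
  assumes C: "linear_monoidal_category R C" "category_of_modules R C U" "tensor_unit_is_ring R C U"
    and R: "cring R" and r: "r \<in> carrier R" and s: "s \<in> carrier R"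
    and eq: "Scl C r (Ide C (Unt C)) = Scl C s (Ide C (Unt C))"
  shows "r = s"
proof -
  interpret cring R by fact
  let ?U = "UObj U (Unt C)"
  have one: "UOne U \<one>\<^bsub>R\<^esub> \<in> carrier ?U"
    using C(3) by (auto simp: tensor_unit_is_ring_def bij_betw_def)
  have "UMap U (Scl C t (Ide C (Unt C))) (UOne U \<one>\<^bsub>R\<^esub>) = UOne U t" if t: "t \<in> carrier R" for t
  proof -
    have "UMap U (Scl C t (Ide C (Unt C))) (UOne U \<one>\<^bsub>R\<^esub>) = t \<odot>\<^bsub>?U\<^esub> UOne U \<one>\<^bsub>R\<^esub>"
      by (rule UMap_Scl_Ide[OF C(2) linear_category[OF C(1)] Unt_Obj[OF C(1)] t one])
    also have "\<dots> = UOne U (t \<otimes>\<^bsub>R\<^esub> \<one>\<^bsub>R\<^esub>)"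
      using C(3) t one_closed unfolding tensor_unit_is_ring_def by metis
    finally show ?thesis using t by simp
  qed
  then have "UOne U r = UOne U s"
    using eq r s by metis
  then show ?thesis
    using C(3) r s by (auto simp: tensor_unit_is_ring_def bij_betw_def dest: inj_onD)
qed

lemma closed_invariant_eqI:
  assumes C: "linear_monoidal_category R C" "category_of_modules R C U" "tensor_unit_is_ring R C U"
    and R: "cring R" and r: "r \<in> carrier R" "Fa L = Scl C r (Ide C (Unt C))"
  shows "closed_invariant R C Fa L = r"
  unfolding closed_invariant_def using r Scl_Ide_Unt_inject[OF C R] by auto

section \<open>Extension of coefficients\<close>

locale coefficient_extension =
  fixes R0 :: "('r0, 'v) ring_scheme" and R1 :: "('r1, 'w) ring_scheme" and \<sigma> :: "'r0 \<Rightarrow> 'r1"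
  assumes R0: "cring R0" and R1: "cring R1" and \<sigma>: "\<sigma> \<in> ring_hom R0 R1"
begin

abbreviation rels :: "('r0, 'm) module \<Rightarrow> ('r1 \<times> 'm \<Rightarrow>\<^sub>0 int) set" where
  "rels \<equiv> ext_relations \<sigma> R0 R1"

lemma \<sigma>_closed: "a \<in> carrier R0 \<Longrightarrow> \<sigma> a \<in> carrier R1"
  using ring_hom_closed[OF \<sigma>] .

lemma carrier_ext_free: "x \<in> carrier (ext_free R1 M) \<longleftrightarrow> Poly_Mapping.keys x \<subseteq> carrier R1 \<times> carrier M"
  by (simp add: ext_free_def)

lemma group_ext_free: "group (ext_free R1 M)"
  by (simp add: ext_free_def)

lemma keys_diff_of:
  "Poly_Mapping.keys (x - frag_of a) \<subseteq> S" if "Poly_Mapping.keys x \<subseteq> S" "a \<in> S"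
  for x :: "'x \<Rightarrow>\<^sub>0 int"
  using that keys_diff[of x "frag_of a"] by auto

lemma rels_subgroup:
  assumes "Module.module R0 M"
  shows "subgroup (rels M) (ext_free R1 M)"
  unfolding ext_relations_def
proof (rule group.generate_is_subgroup[OF group_ext_free])
  interpret R1: cring R1 by (rule R1)
  interpret M: Module.module R0 M by fact
  show "{frag_of (r \<oplus>\<^bsub>R1\<^esub> s, m) - frag_of (r, m) - frag_of (s, m) | r s m.
         r \<in> carrier R1 \<and> s \<in> carrier R1 \<and> m \<in> carrier M} \<union>
      {frag_of (r, m \<oplus>\<^bsub>M\<^esub> n) - frag_of (r, m) - frag_of (r, n) | r m n.
         r \<in> carrier R1 \<and> m \<in> carrier M \<and> n \<in> carrier M} \<union>
      {frag_of (r \<otimes>\<^bsub>R1\<^esub> \<sigma> a, m) - frag_of (r, a \<odot>\<^bsub>M\<^esub> m) | r a m.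
         r \<in> carrier R1 \<and> a \<in> carrier R0 \<and> m \<in> carrier M} \<subseteq> carrier (ext_free R1 M)"
    by (rule subsetI, elim UnE; clarify; simp only: carrier_ext_free;
        intro keys_diff_of; simp add: \<sigma>_closed)
qed

text \<open>Equality of tensors is reduced to membership of differences in \<open>rels M\<close>.\<close>

lemma rels_0: "0 \<in> rels M"
  unfolding ext_relations_def using generate.one[of "ext_free R1 M"] by (simp add: ext_free_def)

lemma rels_add: "x \<in> rels M \<Longrightarrow> y \<in> rels M \<Longrightarrow> x + y \<in> rels M"
  unfolding ext_relations_def using generate.eng[of x "ext_free R1 M"] by (simp add: ext_free_def)

lemma rels_minus: "Module.module R0 M \<Longrightarrow> x \<in> rels M \<Longrightarrow> - x \<in> rels M"
  using subgroup.m_inv_closed[OF rels_subgroup, of M x] subgroup.subset[OF rels_subgroup, of M]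
  by (auto simp: ext_free_def)

lemma rels_diff: "Module.module R0 M \<Longrightarrow> x \<in> rels M \<Longrightarrow> y \<in> rels M \<Longrightarrow> x - y \<in> rels M"
  using rels_add[OF _ rels_minus, of x M y] by simp

lemma mem_ext_class: "y \<in> ext_class \<sigma> R0 R1 M x \<longleftrightarrow> y - x \<in> rels M"
proof -
  have "ext_class \<sigma> R0 R1 M x = (\<lambda>h. h + x) ` rels M"
    by (auto simp: ext_class_def r_coset_def ext_free_def)
  then show ?thesis by (force simp: image_iff)
qed

lemma ext_class_eqI:
  assumes M: "Module.module R0 M" and xy: "x - y \<in> rels M"
  shows "ext_class \<sigma> R0 R1 M x = ext_class \<sigma> R0 R1 M y"
proof -
  have "z - x \<in> rels M \<longleftrightarrow> z - y \<in> rels M" for z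
    using rels_add[OF _ xy, of "z - x"] rels_diff[OF M _ xy, of "z - y"] by auto
  then show ?thesis by (auto simp: mem_ext_class)
qed

lemma carrier_ext_module:
  "t \<in> carrier (ext_module \<sigma> R0 R1 M) \<longleftrightarrow>
     (\<exists>x\<in>carrier (ext_free R1 M). t = ext_class \<sigma> R0 R1 M x)"
  by (auto simp: ext_module_def RCOSETS_def ext_class_def)

text \<open>\<open>on_free f\<close> is \<open>id \<otimes> f\<close> on representatives.\<close>

abbreviation on_free :: "('m \<Rightarrow> 'n) \<Rightarrow> ('r1 \<times> 'm \<Rightarrow>\<^sub>0 int) \<Rightarrow> ('r1 \<times> 'n \<Rightarrow>\<^sub>0 int)" where
  "on_free f \<equiv> frag_extend (\<lambda>(r, m). frag_of (r, f m))"

lemma on_free_closed: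
  assumes "f \<in> carrier M \<rightarrow> carrier N" "x \<in> carrier (ext_free R1 M)"
  shows "on_free f x \<in> carrier (ext_free R1 N)"
proof -
  have "Poly_Mapping.keys (on_free f x) \<subseteq> (\<Union>p\<in>Poly_Mapping.keys x. {(fst p, f (snd p))})"
    using keys_frag_extend[of "\<lambda>(r, m). frag_of (r, f m)" x] by (auto simp: case_prod_beta)
  then show ?thesis
    using assms unfolding carrier_ext_free by fastforce
qed

lemma on_free_comp: "on_free g (on_free f x) = on_free (\<lambda>m. g (f m)) x"
  using frag_extend_compose[of "\<lambda>(r, m). frag_of (r, g m)" "\<lambda>(r, m). (r, f m)" x]
  by (simp add: o_def case_prod_unfold)

text \<open>\<open>id \<otimes> f\<close> sends each of the three kinds of defining relation to a relation of the same kind;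
  so the union in \<open>ext_map\<close> ranges over equal cosets.\<close>

lemma on_free_rels:
  assumes M: "Module.module R0 M" and N: "Module.module R0 N" and f: "linear_map R0 M N f"
    and x: "x \<in> rels M"
  shows "on_free f x \<in> rels N"
proof -
  interpret M: Module.module R0 M by fact
  let ?S = "{frag_of (r \<oplus>\<^bsub>R1\<^esub> s, m) - frag_of (r, m) - frag_of (s, m) | r s m.
         r \<in> carrier R1 \<and> s \<in> carrier R1 \<and> m \<in> carrier M} \<union>
      {frag_of (r, m \<oplus>\<^bsub>M\<^esub> n) - frag_of (r, m) - frag_of (r, n) | r m n.
         r \<in> carrier R1 \<and> m \<in> carrier M \<and> n \<in> carrier M} \<union>
      {frag_of (r \<otimes>\<^bsub>R1\<^esub> \<sigma> a, m) - frag_of (r, a \<odot>\<^bsub>M\<^esub> m) | r a m.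
         r \<in> carrier R1 \<and> a \<in> carrier R0 \<and> m \<in> carrier M}"
  have closed: "\<And>m. m \<in> carrier M \<Longrightarrow> f m \<in> carrier N"
    and add: "\<And>m n. m \<in> carrier M \<Longrightarrow> n \<in> carrier M \<Longrightarrow> f (m \<oplus>\<^bsub>M\<^esub> n) = f m \<oplus>\<^bsub>N\<^esub> f n"
    and smult: "\<And>a m. a \<in> carrier R0 \<Longrightarrow> m \<in> carrier M \<Longrightarrow> f (a \<odot>\<^bsub>M\<^esub> m) = a \<odot>\<^bsub>N\<^esub> f m"
    using f by (auto simp: linear_map_def)
  have S: "on_free f h \<in> rels N" if "h \<in> ?S" for h
    unfolding ext_relations_def
    by (rule generate.incl) (use that in \<open>auto simp: frag_extend_diff closed add smult; blast intro: closed\<close>)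
  have "x \<in> generate (ext_free R1 M) ?S"
    using x by (simp add: ext_relations_def)
  then show ?thesis
  proof (induction rule: generate.induct)
    case one
    then show ?case by (simp add: ext_free_def rels_0)
  next
    case (incl h)
    then show ?case by (rule S)
  next
    case (inv h)
    have "h \<in> rels M"
      unfolding ext_relations_def by (rule generate.incl) (rule inv)
    then have "inv\<^bsub>ext_free R1 M\<^esub> h = - h"
      using subgroup.subset[OF rels_subgroup[OF M]] by (auto simp: ext_free_def)
    then show ?case
      using rels_minus[OF N S[OF inv]] by (simp add: frag_extend_minus)
  next
    case (eng h1 h2)
    then show ?case by (simp add: ext_free_def frag_extend_add rels_add)
  qed
qed

lemma ext_map_class:
  assumes M: "Module.module R0 M" and N: "Module.module R0 N" and f: "linear_map R0 M N f"
  shows "ext_map \<sigma> R0 R1 N f (ext_class \<sigma> R0 R1 M x) = ext_class \<sigma> R0 R1 N (on_free f x)"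
proof -
  have "ext_class \<sigma> R0 R1 N (on_free f y) = ext_class \<sigma> R0 R1 N (on_free f x)"
    if "y \<in> ext_class \<sigma> R0 R1 M x" for y
    using on_free_rels[OF M N f, of "y - x"] that
    by (intro ext_class_eqI[OF N]) (simp add: mem_ext_class frag_extend_diff)
  moreover have "x \<in> ext_class \<sigma> R0 R1 M x"
    by (simp add: mem_ext_class rels_0)
  ultimately show ?thesis
    unfolding ext_map_def by blast
qed

lemma ext_map_closed:
  assumes M: "Module.module R0 M" and N: "Module.module R0 N" and f: "linear_map R0 M N f"
    and t: "t \<in> carrier (ext_module \<sigma> R0 R1 M)"
  shows "ext_map \<sigma> R0 R1 N f t \<in> carrier (ext_module \<sigma> R0 R1 N)"
proof -
  obtain x where x: "x \<in> carrier (ext_free R1 M)" "t = ext_class \<sigma> R0 R1 M x"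
    using t carrier_ext_module by blast
  have "on_free f x \<in> carrier (ext_free R1 N)"
    using f x(1) by (intro on_free_closed[of f M N]) (simp_all add: linear_map_def)
  then show ?thesis
    using carrier_ext_module ext_map_class[OF M N f] x(2) by blast
qed

lemma ext_map_comp:
  assumes M: "Module.module R0 M" and N: "Module.module R0 N" and P: "Module.module R0 P"
    and f: "linear_map R0 M N f" and g: "linear_map R0 N P g" and h: "linear_map R0 M P h"
    and hgf: "\<And>m. m \<in> carrier M \<Longrightarrow> h m = g (f m)"
    and t: "t \<in> carrier (ext_module \<sigma> R0 R1 M)"
  shows "ext_map \<sigma> R0 R1 P h t = ext_map \<sigma> R0 R1 P g (ext_map \<sigma> R0 R1 N f t)"
proof -
  obtain x where x: "x \<in> carrier (ext_free R1 M)" "t = ext_class \<sigma> R0 R1 M x"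
    using t carrier_ext_module by blast
  have "on_free h x = on_free (\<lambda>m. g (f m)) x"
    using x(1) hgf unfolding carrier_ext_free by (intro frag_extend_eq) auto
  then show ?thesis
    by (simp add: x(2) ext_map_class[OF M P h] ext_map_class[OF M N f] ext_map_class[OF N P g]
        on_free_comp)
qed

lemma ext_map_id:
  assumes M: "Module.module R0 M" and f: "linear_map R0 M M f"
    and id: "\<And>m. m \<in> carrier M \<Longrightarrow> f m = m" and t: "t \<in> carrier (ext_module \<sigma> R0 R1 M)"
  shows "ext_map \<sigma> R0 R1 M f t = t"
proof -
  obtain x where x: "x \<in> carrier (ext_free R1 M)" "t = ext_class \<sigma> R0 R1 M x"
    using t carrier_ext_module by blast
  have "on_free f x = frag_extend frag_of x"
    using x(1) id unfolding carrier_ext_free by (intro frag_extend_eq) auto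
  then show ?thesis
    by (simp add: x(2) ext_map_class[OF M M f] frag_expansion[symmetric])
qed

text \<open>Since \<open>s \<otimes> (a \<cdot> m) = (s \<cdot> \<sigma> a) \<otimes> m\<close>, multiplication by \<open>a\<close> on the module becomes
  multiplication by \<open>\<sigma> a\<close> on its extension.\<close>

lemma ext_map_scalar:
  assumes M: "Module.module R0 M" and a: "a \<in> carrier R0"
    and scal: "\<And>m. m \<in> carrier M \<Longrightarrow> f m = a \<odot>\<^bsub>M\<^esub> m"
    and t: "t \<in> carrier (ext_module \<sigma> R0 R1 M)"
  shows "ext_map \<sigma> R0 R1 M f t = \<sigma> a \<odot>\<^bsub>ext_module \<sigma> R0 R1 M\<^esub> t"
proof -
  interpret R1: cring R1 by (rule R1)
  let ?s = "frag_extend (\<lambda>(r, m). frag_of (\<sigma> a \<otimes>\<^bsub>R1\<^esub> r, m))"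
  obtain y where y: "y \<in> carrier (ext_free R1 M)" "t = ext_class \<sigma> R0 R1 M y"
    using t carrier_ext_module by blast
  have "ext_class \<sigma> R0 R1 M (on_free f x) = ext_class \<sigma> R0 R1 M (?s x)" if "x \<in> t" for x
  proof (rule ext_class_eqI[OF M])
    have "x - y \<in> carrier (ext_free R1 M)"
      using that y subgroup.subset[OF rels_subgroup[OF M]] by (auto simp: mem_ext_class)
    then have "Poly_Mapping.keys x \<subseteq> carrier R1 \<times> carrier M"
      using y(1) keys_add[of "x - y" y] unfolding carrier_ext_free by auto
    then show "on_free f x - ?s x \<in> rels M"
    proof (induction x rule: frag_induction)
      case zero
      then show ?case by (simp add: rels_0)
    next
      case (one p)
      obtain r m where p: "p = (r, m)" and r: "r \<in> carrier R1" and m: "m \<in> carrier M"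
        using one by auto
      have "frag_of (r \<otimes>\<^bsub>R1\<^esub> \<sigma> a, m) - frag_of (r, a \<odot>\<^bsub>M\<^esub> m) \<in> rels M"
        unfolding ext_relations_def by (rule generate.incl) (use r a m in blast)
      then have "- (frag_of (r \<otimes>\<^bsub>R1\<^esub> \<sigma> a, m) - frag_of (r, a \<odot>\<^bsub>M\<^esub> m)) \<in> rels M"
        by (rule rels_minus[OF M])
      then show ?case
        using scal[OF m] R1.m_comm[OF r \<sigma>_closed[OF a]] by (simp add: p)
    next
      case (diff x y)
      have "on_free f (x - y) - ?s (x - y) = (on_free f x - ?s x) - (on_free f y - ?s y)"
        by (simp add: frag_extend_diff)
      then show ?case
        using rels_diff[OF M diff] by simp
    qed
  qed
  then show ?thesis
    unfolding ext_map_def ext_module_def by simp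
qed

section \<open>The extended functor\<close>

context
  fixes C :: "('o, 'a, 'r0) linear_cat" and U0 D U1 obs arrs So Sa \<theta>
  assumes C: "linear_monoidal_category R0 C" "category_of_modules R0 C U0"
    and D: "linear_monoidal_category R1 D" "category_of_modules R1 D U1"
    and real: "extension_realized_in \<sigma> R0 R1 C U0 D U1 obs arrs So Sa \<theta>"
begin

lemma So_Obj: "A \<in> obs \<Longrightarrow> So A \<in> Obj D"
  using real by (simp add: extension_realized_in_def)

lemma Sa_Hom: "f \<in> arrs \<Longrightarrow> Sa f \<in> Hom D (So (Src C f)) (So (Tgt C f))"
  using real by (simp add: extension_realized_in_def)

lemma UObj_module: "A \<in> Obj C \<Longrightarrow> Module.module R0 (UObj U0 A)"
  using C(2) by (simp add: category_of_modules_def)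

lemma UMap_linear:
  assumes "f \<in> Hom C A B"
  shows "linear_map R0 (UObj U0 A) (UObj U0 B) (UMap U0 f)"
  using assms C(2) Hom_Obj[OF linear_category[OF C(1)] assms] unfolding category_of_modules_def by blast

lemma UMap_Sa:
  assumes "f \<in> arrs" "t \<in> carrier (ext_module \<sigma> R0 R1 (UObj U0 (Src C f)))"
  shows "UMap U1 (Sa f) (\<theta> (Src C f) t) =
         \<theta> (Tgt C f) (ext_map \<sigma> R0 R1 (UObj U0 (Tgt C f)) (UMap U0 f) t)"
  using assms real by (simp add: extension_realized_in_def)

lemma \<theta>_cases:
  assumes "A \<in> obs" "x \<in> carrier (UObj U1 (So A))"
  obtains t where "t \<in> carrier (ext_module \<sigma> R0 R1 (UObj U0 A))" "x = \<theta> A t"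
  using assms real unfolding extension_realized_in_def bij_betw_def by blast

text \<open>The scalar extension is only given on arrows as some map \<open>Sa\<close> whose underlying linear maps are
\<open>id \<otimes> f\<close>, up to the identifications \<open>\<theta>\<close>.  Functoriality therefore has to be read off from
\<open>id \<otimes> (g \<circ> f) = (id \<otimes> g) \<circ> (id \<otimes> f)\<close>: an arrow of \<open>D\<close> is determined by its
underlying map, and every element of the underlying module is some \<open>\<theta> t\<close>.\<close>

lemma Sa_comp:
  assumes f: "f \<in> arrs" "f \<in> Hom C A B" and g: "g \<in> arrs" "g \<in> Hom C B E"
    and gf: "g \<star>\<^bsub>C\<^esub> f \<in> arrs" and A: "A \<in> obs"
  shows "Sa (g \<star>\<^bsub>C\<^esub> f) = Sa g \<star>\<^bsub>D\<^esub> Sa f"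
proof -
  note catC = linear_category[OF C(1)] and catD = linear_category[OF D(1)]
  have gfH: "g \<star>\<^bsub>C\<^esub> f \<in> Hom C A E"
    by (rule Hom_comp[OF catC f(2) g(2)])
  note [simp] = HomD[OF f(2)] HomD[OF g(2)] HomD[OF gfH]
  have Sf: "Sa f \<in> Hom D (So A) (So B)" and Sg: "Sa g \<in> Hom D (So B) (So E)"
    and Sgf: "Sa (g \<star>\<^bsub>C\<^esub> f) \<in> Hom D (So A) (So E)"
    using Sa_Hom[OF f(1)] Sa_Hom[OF g(1)] Sa_Hom[OF gf] by simp_all
  have mods: "Module.module R0 (UObj U0 A)" "Module.module R0 (UObj U0 B)" "Module.module R0 (UObj U0 E)"
    using UObj_module Hom_Obj[OF catC f(2)] Hom_Obj[OF catC g(2)] by auto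
  show ?thesis
  proof (rule category_of_modules_ext[OF D(2) catD Sgf Hom_comp[OF catD Sf Sg]])
    fix x assume x: "x \<in> carrier (UObj U1 (So A))"
    then obtain t where t: "t \<in> carrier (ext_module \<sigma> R0 R1 (UObj U0 A))" "x = \<theta> A t"
      using \<theta>_cases A by blast
    have "UMap U1 (Sa (g \<star>\<^bsub>C\<^esub> f)) x =
          \<theta> E (ext_map \<sigma> R0 R1 (UObj U0 E) (UMap U0 (g \<star>\<^bsub>C\<^esub> f)) t)"
      using UMap_Sa[OF gf, of t] t by simp
    also have "ext_map \<sigma> R0 R1 (UObj U0 E) (UMap U0 (g \<star>\<^bsub>C\<^esub> f)) t =
        ext_map \<sigma> R0 R1 (UObj U0 E) (UMap U0 g) (ext_map \<sigma> R0 R1 (UObj U0 B) (UMap U0 f) t)"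
    proof (rule ext_map_comp[OF mods UMap_linear[OF f(2)] UMap_linear[OF g(2)] UMap_linear[OF gfH] _ t(1)])
      show "UMap U0 (g \<star>\<^bsub>C\<^esub> f) m = UMap U0 g (UMap U0 f m)" if "m \<in> carrier (UObj U0 A)" for m
        using C(2) that unfolding category_of_modules_def by simp
    qed
    also have "\<theta> E \<dots> = UMap U1 (Sa g) (\<theta> B (ext_map \<sigma> R0 R1 (UObj U0 B) (UMap U0 f) t))"
      using UMap_Sa[OF g(1), of "ext_map \<sigma> R0 R1 (UObj U0 B) (UMap U0 f) t"]
        ext_map_closed[OF mods(1,2) UMap_linear[OF f(2)] t(1)] by simp
    also have "\<theta> B (ext_map \<sigma> R0 R1 (UObj U0 B) (UMap U0 f) t) = UMap U1 (Sa f) x"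
      using UMap_Sa[OF f(1), of t] t by simp
    also have "UMap U1 (Sa g) (UMap U1 (Sa f) x) = UMap U1 (Sa g \<star>\<^bsub>D\<^esub> Sa f) x"
      using D(2) x HomD[OF Sf] HomD[OF Sg] unfolding category_of_modules_def by simp
    finally show "UMap U1 (Sa (g \<star>\<^bsub>C\<^esub> f)) x = UMap U1 (Sa g \<star>\<^bsub>D\<^esub> Sa f) x" .
  qed
qed

lemma Sa_Ide:
  assumes A: "A \<in> obs" "A \<in> Obj C" and I: "Ide C A \<in> arrs"
  shows "Sa (Ide C A) = Ide D (So A)"
proof -
  note catC = linear_category[OF C(1)] and catD = linear_category[OF D(1)]
  have IH: "Ide C A \<in> Hom C A A" and JH: "Ide D (So A) \<in> Hom D (So A) (So A)"
    using catC catD A So_Obj by (auto simp: category_def)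
  note [simp] = HomD[OF IH]
  have SI: "Sa (Ide C A) \<in> Hom D (So A) (So A)"
    using Sa_Hom[OF I] by simp
  show ?thesis
  proof (rule category_of_modules_ext[OF D(2) catD SI JH])
    fix x assume x: "x \<in> carrier (UObj U1 (So A))"
    then obtain t where t: "t \<in> carrier (ext_module \<sigma> R0 R1 (UObj U0 A))" "x = \<theta> A t"
      using \<theta>_cases A by blast
    have "ext_map \<sigma> R0 R1 (UObj U0 A) (UMap U0 (Ide C A)) t = t"
      using C(2) A(2)
      by (intro ext_map_id UObj_module UMap_linear IH t) (auto simp: category_of_modules_def)
    then have "UMap U1 (Sa (Ide C A)) x = x"
      using UMap_Sa[OF I, of t] t by simp
    also have "\<dots> = UMap U1 (Ide D (So A)) x"
      using D(2) x So_Obj[OF A(1)] by (simp add: category_of_modules_def)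
    finally show "UMap U1 (Sa (Ide C A)) x = UMap U1 (Ide D (So A)) x" .
  qed
qed

lemma Sa_Scl_Ide:
  assumes A: "A \<in> obs" "A \<in> Obj C" and a: "a \<in> carrier R0" and I: "Scl C a (Ide C A) \<in> arrs"
  shows "Sa (Scl C a (Ide C A)) = Scl D (\<sigma> a) (Ide D (So A))"
proof -
  note catC = linear_category[OF C(1)] and catD = linear_category[OF D(1)]
  have IH: "Ide C A \<in> Hom C A A" and JH: "Ide D (So A) \<in> Hom D (So A) (So A)"
    using catC catD A So_Obj by (auto simp: category_def)
  note [simp] = HomD[OF Scl_Hom[OF C(1) IH a]]
  have SI: "Sa (Scl C a (Ide C A)) \<in> Hom D (So A) (So A)"
    using Sa_Hom[OF I] by simp
  show ?thesis
  proof (rule category_of_modules_ext[OF D(2) catD SI Scl_Hom[OF D(1) JH \<sigma>_closed[OF a]]])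
    fix x assume x: "x \<in> carrier (UObj U1 (So A))"
    then obtain t where t: "t \<in> carrier (ext_module \<sigma> R0 R1 (UObj U0 A))" "x = \<theta> A t"
      using \<theta>_cases A by blast
    have "UMap U1 (Sa (Scl C a (Ide C A))) x =
        \<theta> A (ext_map \<sigma> R0 R1 (UObj U0 A) (UMap U0 (Scl C a (Ide C A))) t)"
      using UMap_Sa[OF I, of t] t by simp
    also have "ext_map \<sigma> R0 R1 (UObj U0 A) (UMap U0 (Scl C a (Ide C A))) t =
        \<sigma> a \<odot>\<^bsub>ext_module \<sigma> R0 R1 (UObj U0 A)\<^esub> t"
      by (rule ext_map_scalar[OF UObj_module[OF A(2)] a UMap_Scl_Ide[OF C(2) catC A(2) a] t(1)])
    also have "\<theta> A \<dots> = \<sigma> a \<odot>\<^bsub>UObj U1 (So A)\<^esub> x"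
      using real A(1) t \<sigma>_closed[OF a] by (simp add: extension_realized_in_def linear_map_def)
    also have "\<dots> = UMap U1 (Scl D (\<sigma> a) (Ide D (So A))) x"
      using UMap_Scl_Ide[OF D(2) catD So_Obj[OF A(1)] \<sigma>_closed[OF a] x] by simp
    finally show "UMap U1 (Sa (Scl C a (Ide C A))) x = UMap U1 (Scl D (\<sigma> a) (Ide D (So A))) x" .
  qed
qed

end

end

section \<open>Stacking of tangles\<close>

text \<open>The next three sections show that identities and composites of tangle classes are tangle
classes.  This is not part of the definition of \<open>OTa\<close>, whose composition is an operation on
arbitrary sets of polygons, and it is needed because functors respect composition of arrows only.

The lower and the upper half of the slab are treated at once, as the images of the slab under
\<open>half 0\<close> and \<open>half 1\<close>.\<close>

definition half :: "real \<Rightarrow> point \<Rightarrow> point" where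
  "half k = (\<lambda>(x, y, z). (x, y, (z + k) / 2))"

definition unhalf :: "real \<Rightarrow> point \<Rightarrow> point" where
  "unhalf k = (\<lambda>(x, y, z). (x, y, 2 * z - k))"

text \<open>A stack is described from the point of view of either factor: \<open>P\<close> occupies the half \<open>k\<close> and \<open>Q\<close>
the other one.  So a move of \<open>P\<close> covers moves of the upper and of the lower factor.\<close>

definition glue :: "real \<Rightarrow> polygon \<Rightarrow> polygon \<Rightarrow> polygon" where
  "glue k P Q = map_polygon (half k) P \<union> map_polygon (half (1 - k)) Q"

lemma stack_eq_glue: "stack T S = glue 0 S T" "stack T S = glue 1 T S"
  by (simp_all add: stack_def glue_def half_def Un_commute)

lemma unhalf_half [simp]: "unhalf k (half k p) = p" and half_unhalf [simp]: "half k (unhalf k p) = p"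
  by (simp_all add: half_def unhalf_def case_prod_unfold add_divide_distrib diff_divide_distrib)

lemma height_half [simp]: "height (half k p) = (height p + k) / 2"
  by (cases p) (simp add: half_def height_def)

lemma height_unhalf [simp]: "height (unhalf k p) = 2 * height p - k"
  by (cases p) (simp add: unhalf_def height_def)

lemma inj_half: "inj (half k)"
  by (rule inj_on_inverseI[of _ "unhalf k"]) simp

lemma half_eq_iff [simp]: "half k p = half k q \<longleftrightarrow> p = q"
  by (simp add: inj_eq[OF inj_half])

lemma half_slab: "half k ` slab = {p. k / 2 \<le> height p \<and> height p \<le> (k + 1) / 2}"
proof (intro equalityI subsetI)
  fix p assume "p \<in> {p. k / 2 \<le> height p \<and> height p \<le> (k + 1) / 2}"
  then have "unhalf k p \<in> slab" by (simp add: slab_def)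
  then show "p \<in> half k ` slab" by (metis half_unhalf image_eqI)
qed (auto simp: slab_def)

lemma half_segment:
  "closed_segment (half k p) (half k q) = half k ` closed_segment p q" (is ?C)
  "open_segment (half k p) (half k q) = half k ` open_segment p q" (is ?O)
proof -
  have eq: "half k = (\<lambda>p. (0, 0, k / 2) + half 0 p)"
    by (auto simp: half_def fun_eq_iff field_simps)
  have lin: "linear (half 0)"
    by (rule linearI) (auto simp: half_def field_simps)
  show ?C ?O
    unfolding eq closed_segment_translation open_segment_translation
      closed_segment_linear_image[OF lin] open_segment_linear_image[OF lin inj_half]
    by (simp_all add: image_image)
qed

lemma half_linepath: "half k (linepath a b t) = linepath (half k a) (half k b) t"
  by (simp add: half_def linepath_def case_prod_unfold algebra_simps add_divide_distrib diff_divide_distrib)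

lemma continuous_on_half: "continuous_on S (half k)" and continuous_on_unhalf: "continuous_on S (unhalf k)"
  unfolding half_def unhalf_def case_prod_unfold by (intro continuous_intros; simp)+

lemma closed_half_slab: "closed (half k ` slab)"
  unfolding half_slab height_def by (intro closed_Collect_conj closed_Collect_le continuous_intros)

lemma slab_halves: "k \<in> {0, 1} \<Longrightarrow> slab = half k ` slab \<union> half (1 - k) ` slab"
  unfolding half_slab by (auto simp: slab_def)

lemma half_slab_subset: "k \<in> {0, 1} \<Longrightarrow> half k ` slab \<subseteq> slab"
  using slab_halves by blast

lemma halves_meet:
  "k \<in> {0, 1} \<Longrightarrow> p \<in> half k ` slab \<Longrightarrow> p \<in> half (1 - k) ` slab \<Longrightarrow> unhalf k p \<in> slab_boundary"
  unfolding half_slab by (auto simp: slab_boundary_def)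

lemma convex_slab: "convex slab"
proof -
  have "linear height"
    unfolding height_def using linear_compose[OF linear_snd linear_snd] by (simp add: o_def)
  then have "convex (height -` {0..1})"
    by (rule convex_linear_vimage) (rule convex_real_interval)
  moreover have "slab = height -` {0..1}"
    by (auto simp: slab_def)
  ultimately show ?thesis by metis
qed

lemma fst_map_polygon: "fst ` map_polygon f T = f ` fst ` T"
  and snd_map_polygon: "snd ` map_polygon f T = f ` snd ` T"
  by (auto simp: map_polygon_def image_image case_prod_unfold)

lemma tanglesD:
  assumes "T \<in> tangles X Y"
  shows "finite T"
    and "(p, q) \<in> T \<Longrightarrow> p \<noteq> q \<and> p \<in> slab \<and> q \<in> slab \<and> open_segment p q \<subseteq> slab - slab_boundary"
    and "(p, q) \<in> T \<Longrightarrow> (p', q') \<in> T \<Longrightarrow> (p, q) \<noteq> (p', q') \<Longrightarrow>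
      closed_segment p q \<inter> closed_segment p' q' \<subseteq> {p, q} \<inter> {p', q'}"
    and "inj_on fst T" "inj_on snd T" "fst ` T \<inter> snd ` T \<subseteq> slab - slab_boundary"
    and "fst ` T - snd ` T = ends Plus X 0 \<union> ends Minus Y 1"
    and "snd ` T - fst ` T = ends Minus X 0 \<union> ends Plus Y 1"
proof -
  note T = assms[unfolded tangles_def mem_Collect_eq]
  note edges = T[THEN conjunct2, THEN conjunct1]
    and cross = T[THEN conjunct2, THEN conjunct2, THEN conjunct1]
    and vertices = T[THEN conjunct2, THEN conjunct2, THEN conjunct2]
  show "p \<noteq> q \<and> p \<in> slab \<and> q \<in> slab \<and> open_segment p q \<subseteq> slab - slab_boundary"
    if "(p, q) \<in> T"
    using bspec[OF edges that] unfolding prod.case .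
  show "closed_segment p q \<inter> closed_segment p' q' \<subseteq> {p, q} \<inter> {p', q'}"
    if "(p, q) \<in> T" "(p', q') \<in> T" "(p, q) \<noteq> (p', q')"
    using bspec[OF bspec[OF cross that(1), unfolded prod.case] that(2)] that(3)
    by (simp only: prod.case) simp
  show "finite T"
    by (rule T[THEN conjunct1])
  show "inj_on fst T" "inj_on snd T" "fst ` T \<inter> snd ` T \<subseteq> slab - slab_boundary"
    "fst ` T - snd ` T = ends Plus X 0 \<union> ends Minus Y 1"
    "snd ` T - fst ` T = ends Minus X 0 \<union> ends Plus Y 1"
    using vertices by simp_all
qed

lemma tangles_segment_slab:
  assumes "T \<in> tangles X Y" "(p, q) \<in> T"
  shows "closed_segment p q \<subseteq> slab"
  using convex_slab[unfolded convex_contains_segment] tanglesD(2)[OF assms] by blast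

lemma tangles_vertices_slab:
  assumes "T \<in> tangles X Y"
  shows "fst ` T \<union> snd ` T \<subseteq> slab"
proof -
  have "fst e \<in> slab \<and> snd e \<in> slab" if "e \<in> T" for e
    using tanglesD(2)[OF assms, of "fst e" "snd e"] that by simp
  then show ?thesis by (simp add: image_subset_iff)
qed

lemma height_ends: "p \<in> ends s X z \<Longrightarrow> height p = z"
  by (auto simp: ends_def height_def)

lemma half_ends:
  "half 0 ` ends s X 0 = ends s X 0" "half 1 ` ends s X 1 = ends s X 1"
  "half 1 ` ends s X 0 = half 0 ` ends s X 1"
  unfolding ends_def half_def by (auto simp: image_iff)

lemma tangles_boundary_vertices:
  assumes T: "T \<in> tangles X Y" and p: "p \<in> fst ` T \<union> snd ` T"
  shows "height p = 0 \<Longrightarrow> p \<in> ends Plus X 0 \<union> ends Minus X 0"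
    and "height p = 1 \<Longrightarrow> p \<in> ends Plus Y 1 \<union> ends Minus Y 1"
proof -
  have "p \<in> slab_boundary \<Longrightarrow> p \<in> (fst ` T - snd ` T) \<union> (snd ` T - fst ` T)"
    using p tanglesD(6)[OF T] by blast
  then show "height p = 0 \<Longrightarrow> p \<in> ends Plus X 0 \<union> ends Minus X 0"
    "height p = 1 \<Longrightarrow> p \<in> ends Plus Y 1 \<union> ends Minus Y 1"
    unfolding tanglesD(7,8)[OF T] by (auto simp: slab_boundary_def dest: height_ends)
qed

text \<open>The bookkeeping of end points in a stack.  Think of \<open>A\<close> and \<open>B\<close> as the initial and final vertices of the
edges below, of \<open>A'\<close> and \<open>B'\<close> as those above, and of \<open>p\<close> and \<open>m\<close> as the upward and downward strands
at the middle level.  There the strands of one factor end where those of the other begin, so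
exactly the outer ends remain.\<close>

lemma boundary_of_union:
  assumes A: "A - B = a \<union> m" "B - A = b \<union> p" and A': "A' - B' = p \<union> a'" "B' - A' = m \<union> b'"
    and meet: "(A \<union> B) \<inter> (A' \<union> B') \<subseteq> m \<union> p"
    and disj: "a \<inter> m = {}" "b \<inter> p = {}" "p \<inter> a' = {}" "m \<inter> b' = {}"
  shows "A \<inter> A' = {}" "B \<inter> B' = {}"
    and "(A \<union> A') - (B \<union> B') = a \<union> a'" "(B \<union> B') - (A \<union> A') = b \<union> b'"
proof -
  have mem: "(v \<in> A \<and> v \<notin> B \<longleftrightarrow> v \<in> a \<or> v \<in> m) \<and> (v \<in> B \<and> v \<notin> A \<longleftrightarrow> v \<in> b \<or> v \<in> p) \<and>
    (v \<in> A' \<and> v \<notin> B' \<longleftrightarrow> v \<in> p \<or> v \<in> a') \<and> (v \<in> B' \<and> v \<notin> A' \<longleftrightarrow> v \<in> m \<or> v \<in> b') \<and>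
    ((v \<in> A \<or> v \<in> B) \<and> (v \<in> A' \<or> v \<in> B') \<longrightarrow> v \<in> m \<or> v \<in> p) \<and>
    \<not> (v \<in> a \<and> v \<in> m) \<and> \<not> (v \<in> b \<and> v \<in> p) \<and> \<not> (v \<in> p \<and> v \<in> a') \<and> \<not> (v \<in> m \<and> v \<in> b')" for v
    using assms[unfolded set_eq_iff subset_iff Un_iff Int_iff Diff_iff empty_iff] by simp
  have "\<not> (v \<in> A \<and> v \<in> A') \<and> \<not> (v \<in> B \<and> v \<in> B') \<and>
    ((v \<in> A \<or> v \<in> A') \<and> \<not> (v \<in> B \<or> v \<in> B') \<longleftrightarrow> v \<in> a \<or> v \<in> a') \<and>
    ((v \<in> B \<or> v \<in> B') \<and> \<not> (v \<in> A \<or> v \<in> A') \<longleftrightarrow> v \<in> b \<or> v \<in> b')" for v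
    using mem[of v] by argo
  then show "A \<inter> A' = {}" "B \<inter> B' = {}"
    and "(A \<union> A') - (B \<union> B') = a \<union> a'" "(B \<union> B') - (A \<union> A') = b \<union> b'"
    by blast+
qed

lemma map_polygonE:
  assumes "(p, q) \<in> map_polygon f P"
  obtains a b where "(a, b) \<in> P" "p = f a" "q = f b"
  using assms by (auto simp: map_polygon_def)

lemma half_tangle_edge:
  assumes P: "P \<in> tangles X Y" and k: "k \<in> {0, 1}" and pq: "(p, q) \<in> map_polygon (half k) P"
  shows "p \<noteq> q \<and> p \<in> slab \<and> q \<in> slab \<and> open_segment p q \<subseteq> slab - slab_boundary"
proof -
  obtain a b where ab: "(a, b) \<in> P" "p = half k a" "q = half k b"
    using pq by (rule map_polygonE)
  note E = tanglesD(2)[OF P ab(1)]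
  have "half k ` (slab - slab_boundary) \<subseteq> slab - slab_boundary"
    using k by (auto simp: slab_def slab_boundary_def)
  then have "open_segment p q \<subseteq> slab - slab_boundary"
    unfolding ab(2,3) half_segment using E by blast
  moreover have "p \<noteq> q" "p \<in> slab" "q \<in> slab"
    using E half_slab_subset[OF k] by (auto simp: ab(2,3))
  ultimately show ?thesis by blast
qed

lemma half_tangle_disjoint:
  assumes P: "P \<in> tangles X Y" and pq: "(p, q) \<in> map_polygon (half k) P"
    "(p', q') \<in> map_polygon (half k) P" "(p, q) \<noteq> (p', q')"
  shows "closed_segment p q \<inter> closed_segment p' q' \<subseteq> {p, q} \<inter> {p', q'}"
proof -
  obtain a b where ab: "(a, b) \<in> P" "p = half k a" "q = half k b"
    using pq(1) by (rule map_polygonE)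
  obtain a' b' where ab': "(a', b') \<in> P" "p' = half k a'" "q' = half k b'"
    using pq(2) by (rule map_polygonE)
  have "(a, b) \<noteq> (a', b')" using pq(3) ab ab' by blast
  from tanglesD(3)[OF P ab(1) ab'(1) this]
  have "half k ` (closed_segment a b \<inter> closed_segment a' b') \<subseteq> half k ` ({a, b} \<inter> {a', b'})"
    by (rule image_mono)
  then show ?thesis
    unfolding ab(2,3) ab'(2,3) half_segment image_Int[OF inj_half] by simp
qed

text \<open>A point common to both halves lies at height \<open>1 / 2\<close>; an edge of a tangle reaches the
  boundary of the slab only in its end points.\<close>

lemma opposite_halves_disjoint:
  assumes S: "S \<in> tangles X Y" and T: "T \<in> tangles X' Y'"
    and pq: "(p, q) \<in> map_polygon (half 0) S" "(p', q') \<in> map_polygon (half 1) T"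
  shows "closed_segment p q \<inter> closed_segment p' q' \<subseteq> {p, q} \<inter> {p', q'}"
proof
  fix v assume v: "v \<in> closed_segment p q \<inter> closed_segment p' q'"
  obtain a b where ab: "(a, b) \<in> S" "p = half 0 a" "q = half 0 b"
    using pq(1) by (rule map_polygonE)
  obtain a' b' where ab': "(a', b') \<in> T" "p' = half 1 a'" "q' = half 1 b'"
    using pq(2) by (rule map_polygonE)
  obtain s t where s: "s \<in> closed_segment a b" "v = half 0 s"
    and t: "t \<in> closed_segment a' b'" "v = half 1 t"
    using v unfolding ab(2,3) ab'(2,3) half_segment by blast
  have "s \<in> slab" "t \<in> slab"
    using s t tangles_segment_slab[OF S ab(1)] tangles_segment_slab[OF T ab'(1)] by blast+
  moreover have "height s = height t + 1"
    using s(2) t(2) height_half[of 0 s] height_half[of 1 t] by simp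
  ultimately have "s \<in> slab_boundary" "t \<in> slab_boundary"
    unfolding slab_def slab_boundary_def by simp_all
  then have "s \<in> {a, b}" "t \<in> {a', b'}"
    using tanglesD(2)[OF S ab(1)] tanglesD(2)[OF T ab'(1)] s(1) t(1)
    unfolding open_segment_def by blast+
  then have "v \<in> {p, q}" "v \<in> {p', q'}"
    unfolding ab(2,3) ab'(2,3) using s(2) t(2) by blast+
  then show "v \<in> {p, q} \<inter> {p', q'}" by blast
qed

lemma inj_on_map_polygon:
  assumes f: "inj f"
  shows "inj_on fst P \<Longrightarrow> inj_on fst (map_polygon f P)"
    and "inj_on snd P \<Longrightarrow> inj_on snd (map_polygon f P)"
proof -
  have eq: "fst \<circ> (\<lambda>(p, q). (f p, f q)) = f \<circ> fst" "snd \<circ> (\<lambda>(p, q). (f p, f q)) = f \<circ> snd"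
    by (simp_all add: fun_eq_iff case_prod_unfold)
  have f': "inj_on f V" for V
    using f by (rule inj_on_subset) simp
  show "inj_on fst P \<Longrightarrow> inj_on fst (map_polygon f P)"
    "inj_on snd P \<Longrightarrow> inj_on snd (map_polygon f P)"
    unfolding map_polygon_def by (rule inj_on_imageI, unfold eq, rule comp_inj_on, assumption, rule f')+
qed

text \<open>Both factors have the word \<open>Y\<close> at the middle level with the same signs, and a strand that leaves
one factor there enters the other.\<close>

lemma stack_vertices:
  assumes S: "S \<in> tangles X Y" and T: "T \<in> tangles Y Z"
  defines "A \<equiv> half 0 ` fst ` S" and "B \<equiv> half 0 ` snd ` S"
    and "A' \<equiv> half 1 ` fst ` T" and "B' \<equiv> half 1 ` snd ` T"
  shows "A \<inter> A' = {}" "B \<inter> B' = {}"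
    and "(A \<union> A') - (B \<union> B') = ends Plus X 0 \<union> ends Minus Z 1"
    and "(B \<union> B') - (A \<union> A') = ends Minus X 0 \<union> ends Plus Z 1"
    and "(A \<union> A') \<inter> (B \<union> B') \<subseteq> slab - slab_boundary"
proof -
  let ?p = "half 0 ` ends Plus Y 1" and ?m = "half 0 ` ends Minus Y 1"
  have AB: "A - B = ends Plus X 0 \<union> ?m" "B - A = ends Minus X 0 \<union> ?p"
    "A' - B' = ?p \<union> ends Minus Z 1" "B' - A' = ?m \<union> ends Plus Z 1"
    unfolding A_def B_def A'_def B'_def image_set_diff[OF inj_half, symmetric]
      tanglesD(7,8)[OF S] tanglesD(7,8)[OF T] image_Un half_ends by (rule refl)+
  have meet: "(A \<union> B) \<inter> (A' \<union> B') \<subseteq> ?m \<union> ?p"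
  proof
    fix v assume v: "v \<in> (A \<union> B) \<inter> (A' \<union> B')"
    then obtain u where u: "u \<in> fst ` S \<union> snd ` S" "v = half 0 u"
      unfolding A_def B_def by blast
    obtain w where w: "w \<in> fst ` T \<union> snd ` T" "v = half 1 w"
      using v unfolding A'_def B'_def by blast
    have "u \<in> slab" "w \<in> slab"
      using u w tangles_vertices_slab[OF S] tangles_vertices_slab[OF T] by blast+
    moreover have "height u = height w + 1"
      using u(2) w(2) height_half[of 0 u] height_half[of 1 w] by simp
    ultimately have "height u = 1"
      unfolding slab_def by simp
    then have "u \<in> ends Plus Y 1 \<union> ends Minus Y 1"
      by (rule tangles_boundary_vertices(2)[OF S u(1)])
    then show "v \<in> ?m \<union> ?p" using u(2) by blast
  qed
  have half_height: "height v = 1 / 2" if v: "v \<in> ?m \<union> ?p" for v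
  proof -
    obtain s u where "u \<in> ends s Y 1" "v = half 0 u"
      using v by blast
    then show ?thesis using height_ends[of u s Y 1] by simp
  qed
  have "v \<notin> ends s W 0 \<and> v \<notin> ends s W 1" if "v \<in> ?m \<union> ?p" for v s W
    using half_height[OF that] height_ends[of v s W 0] height_ends[of v s W 1] by auto
  then have "ends Plus X 0 \<inter> ?m = {}" "ends Minus X 0 \<inter> ?p = {}"
    "?p \<inter> ends Minus Z 1 = {}" "?m \<inter> ends Plus Z 1 = {}"
    by blast+
  from boundary_of_union[OF AB meet this]
  show "A \<inter> A' = {}" "B \<inter> B' = {}"
    and "(A \<union> A') - (B \<union> B') = ends Plus X 0 \<union> ends Minus Z 1"
    and "(B \<union> B') - (A \<union> A') = ends Minus X 0 \<union> ends Plus Z 1" .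
  show "(A \<union> A') \<inter> (B \<union> B') \<subseteq> slab - slab_boundary"
  proof
    fix v assume v: "v \<in> (A \<union> A') \<inter> (B \<union> B')"
    have int: "A \<inter> B = half 0 ` (fst ` S \<inter> snd ` S)" "A' \<inter> B' = half 1 ` (fst ` T \<inter> snd ` T)"
      unfolding A_def B_def A'_def B'_def image_Int[OF inj_half] by (rule refl)+
    consider "v \<in> A \<inter> B" | "v \<in> A' \<inter> B'" | "v \<in> ?m \<union> ?p"
      using meet v by blast
    then show "v \<in> slab - slab_boundary"
    proof cases
      case 1
      then obtain u where "u \<in> slab - slab_boundary" "v = half 0 u"
        unfolding int using tanglesD(6)[OF S] by blast
      then show ?thesis by (simp add: slab_def slab_boundary_def)
    next
      case 2
      then obtain u where "u \<in> slab - slab_boundary" "v = half 1 u"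
        unfolding int using tanglesD(6)[OF T] by blast
      then show ?thesis by (simp add: slab_def slab_boundary_def)
    next
      case 3
      then have "height v = 1 / 2" by (rule half_height)
      then show ?thesis by (simp add: slab_def slab_boundary_def)
    qed
  qed
qed

lemma stack_tangles:
  assumes S: "S \<in> tangles X Y" and T: "T \<in> tangles Y Z"
  shows "stack T S \<in> tangles X Z"
proof -
  let ?S = "map_polygon (half 0) S" and ?T = "map_polygon (half 1) T"
  have st: "stack T S = ?S \<union> ?T"
    by (simp add: stack_eq_glue(1) glue_def)
  note vertices = stack_vertices[OF S T, folded fst_map_polygon snd_map_polygon]
  have "finite (?S \<union> ?T)"
    using tanglesD(1)[OF S] tanglesD(1)[OF T] by (simp add: map_polygon_def)
  moreover have edge: "p \<noteq> q \<and> p \<in> slab \<and> q \<in> slab \<and> open_segment p q \<subseteq> slab - slab_boundary"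
    if "(p, q) \<in> ?S \<union> ?T" for p q
    using that half_tangle_edge[OF S, of 0] half_tangle_edge[OF T, of 1] by blast
  have "\<forall>(p, q)\<in>?S \<union> ?T. p \<noteq> q \<and> p \<in> slab \<and> q \<in> slab \<and> open_segment p q \<subseteq> slab - slab_boundary"
    by (intro ballI case_prodI2; hypsubst; rule edge; assumption)
  moreover have cross: "closed_segment p q \<inter> closed_segment p' q' \<subseteq> {p, q} \<inter> {p', q'}"
    if e: "(p, q) \<in> ?S \<union> ?T" "(p', q') \<in> ?S \<union> ?T" "(p, q) \<noteq> (p', q')" for p q p' q'
  proof -
    consider "(p, q) \<in> ?S" "(p', q') \<in> ?S" | "(p, q) \<in> ?T" "(p', q') \<in> ?T"
      | "(p, q) \<in> ?S" "(p', q') \<in> ?T" | "(p', q') \<in> ?S" "(p, q) \<in> ?T"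
      using e(1,2) by blast
    then show ?thesis
    proof cases
      case 1
      then show ?thesis using e(3) by (rule half_tangle_disjoint[OF S])
    next
      case 2
      then show ?thesis using e(3) by (rule half_tangle_disjoint[OF T])
    next
      case 3
      then show ?thesis by (rule opposite_halves_disjoint[OF S T])
    next
      case 4
      from opposite_halves_disjoint[OF S T this] show ?thesis by blast
    qed
  qed
  have "\<forall>(p, q)\<in>?S \<union> ?T. \<forall>(p', q')\<in>?S \<union> ?T. (p, q) \<noteq> (p', q') \<longrightarrow>
        closed_segment p q \<inter> closed_segment p' q' \<subseteq> {p, q} \<inter> {p', q'}"
    by (intro ballI case_prodI2 impI; hypsubst; rule cross; assumption)
  moreover have "inj_on fst ?S" "inj_on snd ?S" "inj_on fst ?T" "inj_on snd ?T"
    using inj_on_map_polygon[OF inj_half] tanglesD(4,5)[OF S] tanglesD(4,5)[OF T] by metis+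
  then have "inj_on fst (?S \<union> ?T)" "inj_on snd (?S \<union> ?T)"
    using vertices(1,2) unfolding inj_on_Un by blast+
  ultimately show ?thesis
    unfolding st tangles_def image_Un mem_Collect_eq using vertices(3-5) by (intro conjI)
qed

section \<open>Composition of isotopy classes\<close>

text \<open>\<open>f\<close> performed in one half of the slab, and the identity in the other half.  The two agree on the
common level if \<open>f\<close> fixes the boundary.\<close>

definition act :: "real \<Rightarrow> (point \<Rightarrow> point) \<Rightarrow> point \<Rightarrow> point" where
  "act k f p = (if p \<in> half k ` slab then half k (f (unhalf k p)) else p)"

lemma act_half: "p \<in> slab \<Longrightarrow> act k f (half k p) = half k (f p)"
  by (simp add: act_def)

lemma act_other_half:
  assumes k: "k \<in> {0, 1}" and f: "\<And>p. p \<in> slab_boundary \<Longrightarrow> f p = p" and p: "p \<in> half (1 - k) ` slab"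
  shows "act k f p = p"
  using halves_meet[OF k _ p] f by (simp add: act_def)

lemma act_slab: "k \<in> {0, 1} \<Longrightarrow> f ` slab \<subseteq> slab \<Longrightarrow> act k f ` slab \<subseteq> slab"
  using half_slab_subset[of k] by (auto simp: act_def image_subset_iff)

lemma act_inverse:
  assumes f: "f ` slab \<subseteq> slab" and gf: "\<And>q. q \<in> slab \<Longrightarrow> g (f q) = q"
  shows "act k g (act k f p) = p"
proof (cases "p \<in> half k ` slab")
  case True
  then obtain q where q: "q \<in> slab" "p = half k q" by blast
  then have "f q \<in> slab" using f by auto
  then show ?thesis using q gf by (simp add: act_half)
qed (simp add: act_def)

text \<open>The two halves are closed and the two definitions agree on their intersection, so they can be
pasted.  The parameter space \<open>A\<close> is the time interval for an isotopy and a point for a single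
homeomorphism.\<close>

lemma act_continuous:
  assumes k: "k \<in> {0, 1}" and A: "closed A" and F: "continuous_on (A \<times> slab) F"
    and bd: "\<And>a p. a \<in> A \<Longrightarrow> p \<in> slab_boundary \<Longrightarrow> F (a, p) = p"
  shows "continuous_on (A \<times> slab) (\<lambda>(a, p). act k (\<lambda>q. F (a, q)) p)"
proof -
  have "continuous_on (A \<times> half k ` slab \<union> A \<times> half (1 - k) ` slab)
     (\<lambda>x. if snd x \<in> half k ` slab then half k (F (fst x, unhalf k (snd x))) else snd x)"
  proof (rule continuous_on_cases)
    have "continuous_on (A \<times> half k ` slab) (\<lambda>x. F (fst x, unhalf k (snd x)))"
      by (rule continuous_on_compose2[OF F])
        (auto intro!: continuous_intros continuous_on_compose2[OF continuous_on_unhalf[of UNIV]])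
    then show "continuous_on (A \<times> half k ` slab) (\<lambda>x. half k (F (fst x, unhalf k (snd x))))"
      by (rule continuous_on_compose2[OF continuous_on_half[of UNIV]]) auto
  qed (use A halves_meet[OF k] bd in \<open>auto intro!: closed_Times closed_half_slab continuous_intros\<close>)
  moreover have "A \<times> half k ` slab \<union> A \<times> half (1 - k) ` slab = A \<times> slab"
    using slab_halves[OF k] by blast
  ultimately show ?thesis
    by (simp add: act_def case_prod_unfold)
qed

lemma act_homeomorphism:
  assumes k: "k \<in> {0, 1}" and h: "homeomorphism slab slab f g"
    and bd: "\<And>p. p \<in> slab_boundary \<Longrightarrow> f p = p"
  shows "homeomorphism slab slab (act k f) (act k g)"
proof -
  have sb: "slab_boundary \<subseteq> slab" by (auto simp: slab_boundary_def slab_def)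
  have f: "f ` slab \<subseteq> slab" and g: "g ` slab \<subseteq> slab"
    and gf: "\<And>p. p \<in> slab \<Longrightarrow> g (f p) = p" and fg: "\<And>p. p \<in> slab \<Longrightarrow> f (g p) = p"
    and c: "continuous_on slab f" "continuous_on slab g"
    using h by (auto simp: homeomorphism_def)
  have bdg: "g p = p" if "p \<in> slab_boundary" for p
    using gf[of p] bd[OF that] sb that by auto
  have cont: "continuous_on slab (act k u)"
    if u: "continuous_on slab u" "\<And>p. p \<in> slab_boundary \<Longrightarrow> u p = p" for u
  proof -
    have "continuous_on ({0::real} \<times> slab) (\<lambda>x. u (snd x))"
      by (rule continuous_on_compose2[OF u(1)]) (auto intro!: continuous_intros)
    then have "continuous_on ({0::real} \<times> slab) (\<lambda>(a, p). act k (\<lambda>q. u (snd (a, q))) p)"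
      using u(2) by (intro act_continuous[OF k]) auto
    then have "continuous_on slab (\<lambda>p. (\<lambda>(a, p). act k (\<lambda>q. u (snd (a, q))) p) (0::real, p))"
      by (rule continuous_on_compose2) (auto intro!: continuous_intros)
    then show ?thesis by simp
  qed
  show ?thesis
    by (rule homeomorphismI)
      (use cont c bd bdg act_slab[OF k] f g act_inverse gf fg in auto)
qed

lemma act_ambient_isotopy:
  assumes k: "k \<in> {0, 1}" and H: "ambient_isotopy H"
  shows "ambient_isotopy (\<lambda>(t, p). act k (\<lambda>q. H (t, q)) p)"
  unfolding ambient_isotopy_def
proof (intro conjI ballI)
  have bd: "\<And>t p. t \<in> {0..1} \<Longrightarrow> p \<in> slab_boundary \<Longrightarrow> H (t, p) = p"
    using H by (simp add: ambient_isotopy_def)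
  show "continuous_on ({0..1} \<times> slab) (\<lambda>(t, p). act k (\<lambda>q. H (t, q)) p)"
    using H bd by (intro act_continuous[OF k]) (auto simp: ambient_isotopy_def)
  show "\<exists>G. homeomorphism slab slab (\<lambda>p. case (t, p) of (t, p) \<Rightarrow> act k (\<lambda>q. H (t, q)) p) G"
    if t: "t \<in> {0..1}" for t
  proof -
    obtain G where "homeomorphism slab slab (\<lambda>p. H (t, p)) G"
      using H t unfolding ambient_isotopy_def by blast
    from act_homeomorphism[OF k this bd[OF t]] show ?thesis by auto
  qed
  show "(case (0, p) of (t, p) \<Rightarrow> act k (\<lambda>q. H (t, q)) p) = p" if "p \<in> slab" for p
    using H by (auto simp: ambient_isotopy_def act_def)
  show "(case (t, p) of (t, p) \<Rightarrow> act k (\<lambda>q. H (t, q)) p) = p"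
    if t: "t \<in> {0..1}" and p: "p \<in> slab_boundary" for t p
  proof (cases "p \<in> half k ` slab")
    case True
    then have "unhalf k p \<in> slab_boundary"
      using k p unfolding half_slab by (auto simp: slab_boundary_def)
    then show ?thesis using bd[OF t] by (simp add: act_def)
  qed (simp add: act_def)
  obtain K where K: "compact K" "\<And>t p. t \<in> {0..1} \<Longrightarrow> p \<in> slab - K \<Longrightarrow> H (t, p) = p"
    using H unfolding ambient_isotopy_def by blast
  show "\<exists>K. compact K \<and> (\<forall>t\<in>{0..1}. \<forall>p\<in>slab - K.
      (case (t, p) of (t, p) \<Rightarrow> act k (\<lambda>q. H (t, q)) p) = p)"
  proof (intro exI conjI ballI)
    show "compact (half k ` K)"
      using K(1) continuous_on_half by (rule compact_continuous_image[rotated])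
    fix t :: real and p assume t: "t \<in> {0..1}" and p: "p \<in> slab - half k ` K"
    show "(case (t, p) of (t, p) \<Rightarrow> act k (\<lambda>q. H (t, q)) p) = p"
    proof (cases "p \<in> half k ` slab")
      case True
      then obtain q where q: "q \<in> slab" "p = half k q" by blast
      then have "q \<in> slab - K" using p by blast
      then show ?thesis using K(2)[OF t] q by (simp add: act_half)
    qed (simp add: act_def)
  qed
qed

lemma support_Un: "support (S \<union> T) = support S \<union> support T"
  by (auto simp: support_def)

lemma support_half: "support (map_polygon (half k) T) = half k ` support T"
  by (simp add: support_def map_polygon_def half_segment image_UN case_prod_unfold)

lemma subdivides_refl: "subdivides T T"
  unfolding subdivides_def
proof (intro conjI ballI, simp, clarify)
  fix p q assume "(p, q) \<in> T"
  moreover have "0 \<le> (0::real) \<and> 0 < (1::real) \<and> 1 \<le> (1::real) \<and> p = linepath p q 0 \<and> q = linepath p q 1"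
    by (simp add: linepath_def)
  ultimately show "\<exists>(a, b)\<in>T. \<exists>s t. 0 \<le> s \<and> s < t \<and> t \<le> 1 \<and> p = linepath a b s \<and> q = linepath a b t"
    by blast
qed

lemma subdivides_half:
  assumes "subdivides T T'"
  shows "subdivides (map_polygon (half k) T) (map_polygon (half k) T')"
  unfolding subdivides_def
proof (intro conjI)
  show "support (map_polygon (half k) T') = support (map_polygon (half k) T)"
    using assms by (simp add: support_half subdivides_def)
  show "\<forall>(p, q)\<in>map_polygon (half k) T'. \<exists>(a, b)\<in>map_polygon (half k) T.
      \<exists>s t. 0 \<le> s \<and> s < t \<and> t \<le> 1 \<and> p = linepath a b s \<and> q = linepath a b t"
  proof clarify
    fix p q assume "(p, q) \<in> map_polygon (half k) T'"
    then obtain p' q' where pq: "(p', q') \<in> T'" "p = half k p'" "q = half k q'"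
      by (auto simp: map_polygon_def)
    then obtain a b s t where "(a, b) \<in> T" "0 \<le> s" "s < t" "t \<le> 1"
      "p' = linepath a b s" "q' = linepath a b t"
      using assms[unfolded subdivides_def, THEN conjunct2, THEN bspec, OF pq(1)] by auto
    then show "\<exists>(a, b)\<in>map_polygon (half k) T.
      \<exists>s t. 0 \<le> s \<and> s < t \<and> t \<le> 1 \<and> p = linepath a b s \<and> q = linepath a b t"
      using pq by (intro bexI[of _ "(half k a, half k b)"])
        (auto simp: half_linepath map_polygon_def)
  qed
qed

lemma subdivides_Un: "subdivides S S' \<Longrightarrow> subdivides T T' \<Longrightarrow> subdivides (S \<union> T) (S' \<union> T')"
  unfolding subdivides_def support_Un case_prod_unfold by (simp add: ball_Un bex_Un)

text \<open>The edges of \<open>P\<close> move as before, and those of \<open>Q\<close> lie in the half that is fixed.\<close>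

lemma carries_glue:
  assumes k: "k \<in> {0, 1}" and H: "ambient_isotopy H" "carries H P P'"
    and P: "P \<in> tangles X Y" and Q: "Q \<in> tangles X' Y'"
  shows "carries (\<lambda>(t, p). act k (\<lambda>q. H (t, q)) p) (glue k P Q) (glue k P' Q)"
proof -
  let ?h = "act k (\<lambda>q. H (1, q))"
  have bd: "H (1, p) = p" if "p \<in> slab_boundary" for p
    using H(1) that by (simp add: ambient_isotopy_def)
  have one: "?h (half k p) = half k (H (1, p))" if "p \<in> slab" for p
    by (rule act_half[OF that])
  have two: "?h (half (1 - k) p) = half (1 - k) p" if "p \<in> slab" for p
    using bd that by (intro act_other_half[OF k]) auto
  have P1: "(\<lambda>(p, q). (?h p, ?h q)) ` map_polygon (half k) P = map_polygon (half k) P'"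
  proof -
    have "(\<lambda>(p, q). (?h p, ?h q)) ` map_polygon (half k) P =
        (\<lambda>(p, q). (half k (H (1, p)), half k (H (1, q)))) ` P"
      unfolding map_polygon_def image_image
      by (rule image_cong) (use tanglesD(2)[OF P] one in auto)
    also have "\<dots> = map_polygon (half k) P'"
      using H(2) by (simp add: carries_def map_polygon_def image_image case_prod_unfold)
    finally show ?thesis .
  qed
  have Q1: "(\<lambda>(p, q). (?h p, ?h q)) ` map_polygon (half (1 - k)) Q = map_polygon (half (1 - k)) Q"
    unfolding map_polygon_def image_image
    by (rule image_cong) (use tanglesD(2)[OF Q] two in auto)
  have P2: "?h ` closed_segment p q = closed_segment (?h p) (?h q)"
    if pq: "(p, q) \<in> map_polygon (half k) P" for p q
  proof -
    obtain a b where ab: "(a, b) \<in> P" "p = half k a" "q = half k b"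
      using pq by (auto simp: map_polygon_def)
    have "?h ` closed_segment p q = (\<lambda>s. half k (H (1, s))) ` closed_segment a b"
      unfolding ab half_segment image_image
      by (rule image_cong) (use tangles_segment_slab[OF P ab(1)] one in auto)
    also have "\<dots> = half k ` (\<lambda>s. H (1, s)) ` closed_segment a b"
      by (simp add: image_image)
    also have "(\<lambda>s. H (1, s)) ` closed_segment a b = closed_segment (H (1, a)) (H (1, b))"
      using H(2) ab(1) unfolding carries_def by blast
    also have "half k ` \<dots> = closed_segment (half k (H (1, a))) (half k (H (1, b)))"
      by (simp add: half_segment)
    also have "\<dots> = closed_segment (?h p) (?h q)"
      using tanglesD(2)[OF P ab(1)] one ab by simp
    finally show ?thesis .
  qed
  have Q2: "?h ` closed_segment p q = closed_segment (?h p) (?h q)"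
    if pq: "(p, q) \<in> map_polygon (half (1 - k)) Q" for p q
  proof -
    obtain a b where ab: "(a, b) \<in> Q" "p = half (1 - k) a" "q = half (1 - k) b"
      using pq by (auto simp: map_polygon_def)
    have "?h ` closed_segment p q = half (1 - k) ` closed_segment a b"
      unfolding ab half_segment image_image
      by (rule image_cong) (use tangles_segment_slab[OF Q ab(1)] two in auto)
    then show ?thesis
      using tanglesD(2)[OF Q ab(1)] two ab by (simp add: half_segment)
  qed
  have "map_polygon (half k) P' \<union> map_polygon (half (1 - k)) Q =
      (\<lambda>(p, q). (?h p, ?h q)) ` (map_polygon (half k) P \<union> map_polygon (half (1 - k)) Q)"
    by (simp only: image_Un P1 Q1)
  moreover have segment: "?h ` closed_segment p q = closed_segment (?h p) (?h q)"
    if "(p, q) \<in> map_polygon (half k) P \<union> map_polygon (half (1 - k)) Q" for p q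
    using that P2 Q2 by blast
  have "\<forall>(p, q)\<in>map_polygon (half k) P \<union> map_polygon (half (1 - k)) Q.
      ?h ` closed_segment p q = closed_segment (?h p) (?h q)"
    by (intro ballI case_prodI2; hypsubst; rule segment; assumption)
  ultimately show ?thesis
    unfolding carries_def glue_def prod.case by (rule conjI)
qed

lemma tangle_move_glue:
  assumes k: "k \<in> {0, 1}" and move: "tangle_move X Y P P'" and Q: "Q \<in> tangles X' Y'"
    and glued: "glue k P Q \<in> tangles V W" "glue k P' Q \<in> tangles V W"
  shows "tangle_move V W (glue k P Q) (glue k P' Q)"
proof -
  have P: "P \<in> tangles X Y" using move by (simp add: tangle_move_def)
  consider "subdivides P P'" | H where "ambient_isotopy H" "carries H P P'"
    using move unfolding tangle_move_def by (elim conjE disjE exE)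
  then have "subdivides (glue k P Q) (glue k P' Q) \<or>
      (\<exists>H. ambient_isotopy H \<and> carries H (glue k P Q) (glue k P' Q))"
  proof cases
    case 1
    then have "subdivides (glue k P Q) (glue k P' Q)"
      unfolding glue_def by (intro subdivides_Un subdivides_half subdivides_refl)
    then show ?thesis ..
  next
    case 2
    then show ?thesis
      using act_ambient_isotopy[OF k 2(1)] carries_glue[OF k 2 P Q] by (intro disjI2 exI conjI)
  qed
  with glued show ?thesis
    unfolding tangle_move_def by (intro conjI)
qed

lemma tangle_move_tangles:
  assumes "tangle_move X Y T T'"
  shows "T \<in> tangles X Y" "T' \<in> tangles X Y"
  by (rule assms[unfolded tangle_move_def, THEN conjunct1],
      rule assms[unfolded tangle_move_def, THEN conjunct2, THEN conjunct1])

lemma isotopic_map: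
  assumes iso: "isotopic X Y P P'" and P: "P \<in> tangles X Y"
    and f: "\<And>R R'. tangle_move X Y R R' \<Longrightarrow> tangle_move V W (f R) (f R')"
  shows "P' \<in> tangles X Y \<and> isotopic V W (f P) (f P')"
  using iso[unfolded isotopic_def]
proof (induction rule: equivclp_induct)
  case base
  then show ?case using P by (simp add: isotopic_def)
next
  case (step R R')
  from step(2) have "R' \<in> tangles X Y"
    by (elim disjE) (erule tangle_move_tangles)+
  moreover have "tangle_move V W (f R) (f R') \<or> tangle_move V W (f R') (f R)"
    using step(2) f[of R R'] f[of R' R] by argo
  then have "isotopic V W (f P) (f R')"
    using step.IH[THEN conjunct2] unfolding isotopic_def by (rule equivclp_into_equivclp[rotated])
  ultimately show ?case ..
qed

text \<open>The two factors are moved one after the other.\<close>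

lemma isotopic_stack:
  assumes S: "S \<in> tangles X Y" "isotopic X Y S S'" and T: "T \<in> tangles Y Z" "isotopic Y Z T T'"
  shows "isotopic X Z (stack T S) (stack T' S')"
proof -
  have T': "T' \<in> tangles Y Z \<and> isotopic X Z (stack T S) (stack T' S)"
  proof (rule isotopic_map[OF T(2,1)])
    fix R R' assume m: "tangle_move Y Z R R'"
    show "tangle_move X Z (stack R S) (stack R' S)"
      using tangle_move_glue[of 1, OF _ m S(1)] stack_tangles[OF S(1) tangle_move_tangles(1)[OF m]]
        stack_tangles[OF S(1) tangle_move_tangles(2)[OF m]]
      by (simp only: stack_eq_glue(2) insert_iff simp_thms)
  qed
  have S': "S' \<in> tangles X Y \<and> isotopic X Z (stack T' S) (stack T' S')"
  proof (rule isotopic_map[OF S(2,1)])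
    fix R R' assume m: "tangle_move X Y R R'"
    show "tangle_move X Z (stack T' R) (stack T' R')"
      using tangle_move_glue[of 0, OF _ m T'[THEN conjunct1]]
        stack_tangles[OF tangle_move_tangles(1)[OF m] T'[THEN conjunct1]]
        stack_tangles[OF tangle_move_tangles(2)[OF m] T'[THEN conjunct1]]
      by (simp only: stack_eq_glue(1) insert_iff simp_thms)
  qed
  show ?thesis
    using T'[THEN conjunct2] S'[THEN conjunct2] unfolding isotopic_def by (rule equivclp_trans)
qed

lemma OTa_comp_class:
  assumes S: "S \<in> tangles X Y" and T: "T \<in> tangles Y Z"
  shows "tangle_class Y Z T \<star>\<^bsub>OTa\<^esub> tangle_class X Y S = tangle_class X Z (stack T S)"
proof -
  have "{R. \<exists>T'\<in>{T'. isotopic Y Z T T'}. \<exists>S'\<in>{S'. isotopic X Y S S'}. isotopic X Z (stack T' S') R} =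
      {R. isotopic X Z (stack T S) R}" (is "?L = ?R")
  proof (intro equalityI subsetI)
    fix R assume "R \<in> ?L"
    then obtain T' S' where "isotopic Y Z T T'" "isotopic X Y S S'" and R: "isotopic X Z (stack T' S') R"
      by blast
    then have "isotopic X Z (stack T S) (stack T' S')"
      by (intro isotopic_stack[OF S _ T])
    then have "isotopic X Z (stack T S) R"
      using R unfolding isotopic_def by (rule equivclp_trans)
    then show "R \<in> ?R" by simp
  next
    fix R assume "R \<in> ?R"
    moreover have "isotopic Y Z T T" "isotopic X Y S S"
      unfolding isotopic_def by (rule equivclp_refl)+
    ultimately show "R \<in> ?L" by blast
  qed
  then show ?thesis
    by (simp add: OTa_def OTa_comp_def tangle_class_def)
qed

lemma OTa_simps:
  "Obj OTa = UNIV" "Src OTa (tangle_class X Y T) = X" "Tgt OTa (tangle_class X Y T) = Y"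
  "Unt OTa = []"
  by (simp_all add: OTa_def tangle_class_def)

lemma OTa_Arr: "f \<in> Arr OTa \<longleftrightarrow> (\<exists>X Y T. T \<in> tangles X Y \<and> f = tangle_class X Y T)"
  by (auto simp: OTa_def)

text \<open>Because stacking respects isotopy, the composite of two classes is the class of any stack of
representatives, and this stack is again a tangle.\<close>

lemma OTa_comp_Hom:
  assumes f: "f \<in> Arr OTa" and g: "g \<in> Arr OTa" and fg: "Tgt OTa f = Src OTa g"
  shows "g \<star>\<^bsub>OTa\<^esub> f \<in> Hom OTa (Src OTa f) (Tgt OTa g)"
proof -
  obtain X Y S where S: "S \<in> tangles X Y" "f = tangle_class X Y S"
    using f unfolding OTa_Arr by (elim exE conjE)
  obtain Z T where T: "T \<in> tangles Y Z" "g = tangle_class Y Z T"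
  proof -
    obtain Y' Z T where T: "T \<in> tangles Y' Z" "g = tangle_class Y' Z T"
      using g unfolding OTa_Arr by (elim exE conjE)
    moreover have "Y' = Y"
      using fg S(2) T(2) by (simp add: OTa_simps)
    ultimately show thesis using that by simp
  qed
  have gf: "g \<star>\<^bsub>OTa\<^esub> f = tangle_class X Z (stack T S)"
    unfolding S(2) T(2) by (rule OTa_comp_class[OF S(1) T(1)])
  have "g \<star>\<^bsub>OTa\<^esub> f \<in> Arr OTa"
    using stack_tangles[OF S(1) T(1)] gf OTa_Arr by blast
  then show ?thesis
    unfolding Hom_def gf by (simp add: S(2) T(2) OTa_simps)
qed

section \<open>Identity tangles\<close>

lemma vertical_segment:
  "v \<in> closed_segment (a, b, 0) (a, b, 1 :: real) \<Longrightarrow> fst v = a"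
  "open_segment (a, b, 0) (a, b, 1) \<subseteq> slab - slab_boundary"
proof -
  show "v \<in> closed_segment (a, b, 0) (a, b, 1 :: real) \<Longrightarrow> fst v = a"
    by (auto simp: in_segment algebra_simps)
  show "open_segment (a, b, 0) (a, b, 1) \<subseteq> slab - slab_boundary"
    by (auto simp: in_segment slab_def slab_boundary_def height_def)
qed

lemma identity_tangles: "identity_tangle X \<in> tangles X X"
proof -
  let ?I = "identity_tangle X"
  have edge: "\<exists>i. closed_segment p q = closed_segment (real (i + 1), 0, 0) (real (i + 1), 0, 1) \<and>
      open_segment p q = open_segment (real (i + 1), 0, 0) (real (i + 1), 0, 1) \<and>
      (X ! i = Plus \<and> p = (real (i + 1), 0, 0) \<and> q = (real (i + 1), 0, 1) \<or>
       X ! i = Minus \<and> p = (real (i + 1), 0, 1) \<and> q = (real (i + 1), 0, 0))"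
    if "(p, q) \<in> ?I" for p q
  proof -
    obtain i where "X ! i = Plus \<and> p = (real (i + 1), 0, 0) \<and> q = (real (i + 1), 0, 1) \<or>
       X ! i = Minus \<and> p = (real (i + 1), 0, 1) \<and> q = (real (i + 1), 0, 0)"
      using \<open>(p, q) \<in> ?I\<close> unfolding identity_tangle_def by blast
    then show ?thesis
      using closed_segment_commute[of p q] open_segment_commute[of p q] by (intro exI[of _ i]) metis
  qed
  have fst: "fst ` ?I = ends Plus X 0 \<union> ends Minus X 1"
    and snd: "snd ` ?I = ends Minus X 0 \<union> ends Plus X 1"
    unfolding identity_tangle_def ends_def image_Un by (simp_all add: setcompr_eq_image image_image Un_commute)
  have disjoint: "(ends Plus X 0 \<union> ends Minus X 1) \<inter> (ends Minus X 0 \<union> ends Plus X 1) = {}"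
    by (auto simp: ends_def)
  have "?I \<subseteq> (\<lambda>i. ((real (i + 1), 0, 0), (real (i + 1), 0, 1))) ` {..<length X} \<union>
      (\<lambda>i. ((real (i + 1), 0, 1), (real (i + 1), 0, 0))) ` {..<length X}"
    by (auto simp: identity_tangle_def)
  then have "finite ?I"
    by (rule finite_subset) simp
  moreover have "\<forall>(p, q)\<in>?I. p \<noteq> q \<and> p \<in> slab \<and> q \<in> slab \<and> open_segment p q \<subseteq> slab - slab_boundary"
  proof (intro ballI case_prodI2, hypsubst)
    fix p q assume "(p, q) \<in> ?I"
    from edge[OF this] obtain i
      where i: "open_segment p q = open_segment (real (i + 1), 0, 0) (real (i + 1), 0, 1)"
        "p = (real (i + 1), 0, 0) \<and> q = (real (i + 1), 0, 1) \<or>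
         p = (real (i + 1), 0, 1) \<and> q = (real (i + 1), 0, 0)"
      by blast
    from i(2) have "p \<noteq> q \<and> p \<in> slab \<and> q \<in> slab"
      by (elim disjE conjE) (simp_all add: slab_def height_def)
    then show "p \<noteq> q \<and> p \<in> slab \<and> q \<in> slab \<and> open_segment p q \<subseteq> slab - slab_boundary"
      unfolding i(1) using vertical_segment(2) by blast
  qed
  moreover have "\<forall>(p, q)\<in>?I. \<forall>(p', q')\<in>?I. (p, q) \<noteq> (p', q') \<longrightarrow>
      closed_segment p q \<inter> closed_segment p' q' \<subseteq> {p, q} \<inter> {p', q'}"
  proof (intro ballI case_prodI2 impI, hypsubst)
    fix p q p' q' assume 1: "(p, q) \<in> ?I" "(p', q') \<in> ?I" "(p, q) \<noteq> (p', q')"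
    obtain i where i: "closed_segment p q = closed_segment (real (i + 1), 0, 0) (real (i + 1), 0, 1)"
      "X ! i = Plus \<and> p = (real (i + 1), 0, 0) \<and> q = (real (i + 1), 0, 1) \<or>
       X ! i = Minus \<and> p = (real (i + 1), 0, 1) \<and> q = (real (i + 1), 0, 0)"
      using edge[OF 1(1)] by blast
    obtain j where j: "closed_segment p' q' = closed_segment (real (j + 1), 0, 0) (real (j + 1), 0, 1)"
      "X ! j = Plus \<and> p' = (real (j + 1), 0, 0) \<and> q' = (real (j + 1), 0, 1) \<or>
       X ! j = Minus \<and> p' = (real (j + 1), 0, 1) \<and> q' = (real (j + 1), 0, 0)"
      using edge[OF 1(2)] by blast
    have "i \<noteq> j" using i(2) j(2) 1(3) by auto
    have "closed_segment p q \<inter> closed_segment p' q' = {}"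
    proof (rule equals0I)
      fix v assume "v \<in> closed_segment p q \<inter> closed_segment p' q'"
      then have "fst v = real (i + 1)" "fst v = real (j + 1)"
        unfolding i(1) j(1) by (auto dest: vertical_segment(1))
      then show False using \<open>i \<noteq> j\<close> by simp
    qed
    then show "closed_segment p q \<inter> closed_segment p' q' \<subseteq> {p, q} \<inter> {p', q'}"
      by simp
  qed
  moreover have "inj_on fst ?I" "inj_on snd ?I"
    by (auto simp: identity_tangle_def inj_on_def)
  moreover have "fst ` ?I - snd ` ?I = fst ` ?I" "snd ` ?I - fst ` ?I = snd ` ?I"
    "fst ` ?I \<inter> snd ` ?I \<subseteq> slab - slab_boundary"
    using disjoint unfolding fst snd by blast+
  ultimately show ?thesis
    unfolding tangles_def mem_Collect_eq fst snd by (intro conjI)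
qed

lemma OTa_Ide_Hom: "Ide OTa X \<in> Hom OTa X X"
proof -
  have "Ide OTa X = tangle_class X X (identity_tangle X)"
    by (simp add: OTa_def)
  then show ?thesis
    using identity_tangles[of X] unfolding Hom_def OTa_Arr by (auto simp: OTa_simps)
qed

section \<open>Transport along a decomposition\<close>

text \<open>What \<open>F\<^sub>1\<close> and \<open>\<sigma>\<^sub>* \<circ> F\<^sub>0\<close> have in common once both are regarded as taking values in the
common category.\<close>

definition tangle_functor ::
  "('o, 'a, 'z) monoidal_cat_scheme \<Rightarrow> (sign list \<Rightarrow> 'o) \<Rightarrow> (tangle_class \<Rightarrow> 'a) \<Rightarrow> bool" where
  "tangle_functor D Fo Fa \<longleftrightarrow>
     (\<forall>X Y. \<forall>f\<in>Hom OTa X Y. Fa f \<in> Hom D (Fo X) (Fo Y)) \<and>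
     (\<forall>X. Fa (Ide OTa X) = Ide D (Fo X)) \<and>
     (\<forall>X Y Z. \<forall>f\<in>Hom OTa X Y. \<forall>g\<in>Hom OTa Y Z. Fa (g \<star>\<^bsub>OTa\<^esub> f) = Fa g \<star>\<^bsub>D\<^esub> Fa f)"

lemma strict_monoidal_functor_tangle_functor:
  assumes F: "strict_monoidal_functor OTa C Fo Fa"
  shows "tangle_functor C Fo Fa"
  unfolding tangle_functor_def
proof (intro conjI allI ballI)
  fix X Y Z f g
  show "Fa (Ide OTa X) = Ide C (Fo X)"
    using F by (simp add: strict_monoidal_functor_def OTa_simps)
  show "Fa f \<in> Hom C (Fo X) (Fo Y)" if "f \<in> Hom OTa X Y"
    using F HomD[OF that] by (auto simp: strict_monoidal_functor_def)
  show "Fa (g \<star>\<^bsub>OTa\<^esub> f) = Fa g \<star>\<^bsub>C\<^esub> Fa f" if "f \<in> Hom OTa X Y" "g \<in> Hom OTa Y Z"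
    using F HomD[OF that(1)] HomD[OF that(2)] by (simp add: strict_monoidal_functor_def)
qed

lemma tangle_functorD:
  assumes "tangle_functor D Fo Fa"
  shows "f \<in> Hom OTa X Y \<Longrightarrow> Fa f \<in> Hom D (Fo X) (Fo Y)"
    and "Fa (Ide OTa X) = Ide D (Fo X)"
    and "f \<in> Hom OTa X Y \<Longrightarrow> g \<in> Hom OTa Y Z \<Longrightarrow> Fa (g \<star>\<^bsub>OTa\<^esub> f) = Fa g \<star>\<^bsub>D\<^esub> Fa f"
  using assms unfolding tangle_functor_def by simp_all

lemma realized_tangle_functor:
  assumes F: "tangle_functor C Fo Fa" and real: "realized_in C D R (range Fo) (Fa ` Arr OTa)"
  shows "tangle_functor D Fo Fa"
  unfolding tangle_functor_def
proof (intro conjI allI ballI)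
  fix X Y Z f g
  show "Fa (Ide OTa X) = Ide D (Fo X)"
    using tangle_functorD(2)[OF F] real by (simp add: realized_in_def)
  show "Fa f \<in> Hom D (Fo X) (Fo Y)" if "f \<in> Hom OTa X Y"
    using HomD[OF that] HomD[OF tangle_functorD(1)[OF F that]] real
    by (auto simp: realized_in_def Hom_def)
  show "Fa (g \<star>\<^bsub>OTa\<^esub> f) = Fa g \<star>\<^bsub>D\<^esub> Fa f" if f: "f \<in> Hom OTa X Y" and g: "g \<in> Hom OTa Y Z"
  proof -
    have "Fa g \<star>\<^bsub>D\<^esub> Fa f = Fa g \<star>\<^bsub>C\<^esub> Fa f"
      using HomD[OF f] HomD[OF g] HomD[OF tangle_functorD(1)[OF F f]]
        HomD[OF tangle_functorD(1)[OF F g]] real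
      by (simp add: realized_in_def)
    then show ?thesis using tangle_functorD(3)[OF F f g] by simp
  qed
qed

lemma (in coefficient_extension) extended_tangle_functor:
  assumes C: "linear_monoidal_category R0 C" "category_of_modules R0 C U0"
    and D: "linear_monoidal_category R1 D" "category_of_modules R1 D U1"
    and F: "tangle_functor C Fo Fa"
    and real: "extension_realized_in \<sigma> R0 R1 C U0 D U1 (range Fo) (Fa ` Arr OTa) So Sa \<theta>"
  shows "tangle_functor D (\<lambda>X. So (Fo X)) (\<lambda>f. Sa (Fa f))"
  unfolding tangle_functor_def
proof (intro conjI allI ballI)
  fix X Y Z f g
  have I: "Ide OTa X \<in> Hom OTa X X"
    by (rule OTa_Ide_Hom)
  have "Fo X \<in> Obj C"
    using Hom_Obj[OF linear_category[OF C(1)] tangle_functorD(1)[OF F I]] by simp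
  then show "Sa (Fa (Ide OTa X)) = Ide D (So (Fo X))"
    using Sa_Ide[OF C D real, of "Fo X"] tangle_functorD(2)[OF F, of X] HomD[OF I] by force
  show "Sa (Fa f) \<in> Hom D (So (Fo X)) (So (Fo Y))" if "f \<in> Hom OTa X Y"
    using Sa_Hom[OF C D real, of "Fa f"] HomD[OF that] HomD[OF tangle_functorD(1)[OF F that]] by simp
  show "Sa (Fa (g \<star>\<^bsub>OTa\<^esub> f)) = Sa (Fa g) \<star>\<^bsub>D\<^esub> Sa (Fa f)"
    if f: "f \<in> Hom OTa X Y" and g: "g \<in> Hom OTa Y Z"
  proof -
    have gf: "g \<star>\<^bsub>OTa\<^esub> f \<in> Arr OTa"
      using OTa_comp_Hom[of f g] HomD[OF f] HomD[OF g] by (simp add: Hom_def)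
    have "Fa g \<star>\<^bsub>C\<^esub> Fa f \<in> Fa ` Arr OTa"
      using tangle_functorD(3)[OF F f g] gf by (metis imageI)
    then show ?thesis
      using Sa_comp[OF C D real _ tangle_functorD(1)[OF F f] _ tangle_functorD(1)[OF F g]]
        HomD[OF f] HomD[OF g] tangle_functorD(3)[OF F f g] by simp
  qed
qed

lemma layer_Arr: "layer E \<Longrightarrow> E \<in> Arr OTa"
  using OTa_Ide_Hom by (auto simp: layer_def elementary_slice_def Hom_def)

text \<open>Every partial product of a decomposition is an arrow, so functors can be applied to it.\<close>

lemma decomposition_Arr: "decomposition Es T \<Longrightarrow> T \<in> Arr OTa"
proof (induction rule: decomposition.induct)
  case (single E)
  then show ?case by (rule layer_Arr)
next
  case (step Es T E)
  from OTa_comp_Hom[OF step.IH layer_Arr[OF step.hyps(2)] step.hyps(3)] show ?case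
    by (simp add: Hom_def)
qed

text \<open>Decomposition-independence includes that every tangle has a decomposition, and the defect of the
tangle is the product along any one of them.\<close>

lemma tangle_defect_decomposition:
  assumes "defects_give_scalars R \<alpha>" "T \<in> Arr OTa"
  obtains Es where "decomposition Es T" "tangle_defect R \<alpha> T = defect_product R \<alpha> Es"
proof -
  have "\<exists>!c. \<exists>Es. decomposition Es T \<and> defect_product R \<alpha> Es = c"
    using assms by (simp add: defects_give_scalars_def)
  from theI'[OF this] show thesis
    using that unfolding tangle_defect_def by metis
qed

context
  fixes R :: "('r, 'w) ring_scheme" and D :: "('o, 'a, 'r, 'z) linear_cat_scheme"
    and Fo Po :: "sign list \<Rightarrow> 'o" and Fa Pa :: "tangle_class \<Rightarrow> 'a"
    and B :: "sign list \<Rightarrow> 'a" and \<alpha> :: "tangle_class \<Rightarrow> 'r"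
  assumes R: "cring R" and D: "linear_monoidal_category R D"
    and F: "tangle_functor D Fo Fa" and P: "tangle_functor D Po Pa"
    and B: "\<And>X. B X \<in> Iso D (Fo X) (Po X)"
    and slices: "\<And>E. elementary_slice E \<Longrightarrow> \<alpha> E \<in> carrier R \<and> Fa E = transported D B Pa (\<alpha> E) E"
begin

interpretation R: cring R by (rule R)

text \<open>Transport is multiplicative: the comparison at the intermediate word cancels.\<close>

lemma transported_comp:
  assumes f: "f \<in> Hom OTa X Y" and g: "g \<in> Hom OTa Y Z" and a: "a \<in> carrier R" and c: "c \<in> carrier R"
  shows "transported D B Pa a g \<star>\<^bsub>D\<^esub> transported D B Pa c f =
    transported D B Pa (a \<otimes>\<^bsub>R\<^esub> c) (g \<star>\<^bsub>OTa\<^esub> f)"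
proof -
  have gf: "g \<star>\<^bsub>OTa\<^esub> f \<in> Hom OTa X Z"
    using OTa_comp_Hom[of f g] HomD[OF f] HomD[OF g] by simp
  show ?thesis
    unfolding transported_def tangle_functorD(3)[OF P f g]
    using scaled_conjugates_comp[OF D B B B tangle_functorD(1)[OF P f] tangle_functorD(1)[OF P g] a c]
    by (simp add: HomD[OF f] HomD[OF g] HomD[OF gf])
qed

lemma transported_Ide: "transported D B Pa \<one>\<^bsub>R\<^esub> (Ide OTa X) = Ide D (Fo X)"
proof -
  note cat = linear_category[OF D]
  have BH: "B X \<in> Hom D (Fo X) (Po X)"
    using B[of X] by (simp add: Iso_def)
  have I: "Ide D (Fo X) \<in> Hom D (Fo X) (Fo X)"
    using tangle_functorD(1)[OF F OTa_Ide_Hom] by (simp add: tangle_functorD(2)[OF F])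
  show ?thesis
    unfolding transported_def tangle_functorD(2)[OF P]
    using comp_Ide[OF cat BH] inv_arr_inverse(2)[OF cat B] Scl_one[OF D I, of "\<one>\<^bsub>R\<^esub>"]
    by (simp add: HomD[OF OTa_Ide_Hom])
qed

lemma transport_layer:
  assumes "layer E"
  shows "layer_defect R \<alpha> E \<in> carrier R \<and> Fa E = transported D B Pa (layer_defect R \<alpha> E) E"
proof (cases "E \<in> range (Ide OTa)")
  case True
  then show ?thesis
    using transported_Ide tangle_functorD(2)[OF F] by (auto simp: layer_defect_def)
next
  case False
  then show ?thesis
    using assms slices by (simp add: layer_defect_def layer_def)
qed

text \<open>Layers are added at the top, which multiplies the scalar by their defects from the left, as in
the definition of \<open>defect_product\<close>.\<close>

lemma transport_decomposition:
  assumes "decomposition Es T"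
  shows "defect_product R \<alpha> Es \<in> carrier R \<and> Fa T = transported D B Pa (defect_product R \<alpha> Es) T"
  using assms
proof (induction rule: decomposition.induct)
  case (single E)
  then show ?case
    using transport_layer[of E] by (simp add: defect_product_def)
next
  case (step Es T E)
  have T: "T \<in> Hom OTa (Src OTa T) (Src OTa E)"
    using decomposition_Arr[OF step.hyps(1)] step.hyps(3) by (simp add: Hom_def)
  have E: "E \<in> Hom OTa (Src OTa E) (Tgt OTa E)"
    using layer_Arr[OF step.hyps(2)] by (simp add: Hom_def)
  have prod: "defect_product R \<alpha> (E # Es) = layer_defect R \<alpha> E \<otimes>\<^bsub>R\<^esub> defect_product R \<alpha> Es"
    by (simp add: defect_product_def)
  have "Fa (E \<star>\<^bsub>OTa\<^esub> T) = Fa E \<star>\<^bsub>D\<^esub> Fa T"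
    by (rule tangle_functorD(3)[OF F T E])
  also have "\<dots> = transported D B Pa (layer_defect R \<alpha> E) E \<star>\<^bsub>D\<^esub>
      transported D B Pa (defect_product R \<alpha> Es) T"
    using transport_layer[OF step.hyps(2)] step.IH by simp
  also have "\<dots> = transported D B Pa (defect_product R \<alpha> (E # Es)) (E \<star>\<^bsub>OTa\<^esub> T)"
    unfolding prod using transported_comp[OF T E] transport_layer[OF step.hyps(2)] step.IH by simp
  finally show ?case
    using prod transport_layer[OF step.hyps(2)] step.IH by simp
qed

lemma transport_tangle:
  assumes "defects_give_scalars R \<alpha>" "T \<in> Arr OTa"
  shows "tangle_defect R \<alpha> T \<in> carrier R \<and> Fa T = transported D B Pa (tangle_defect R \<alpha> T) T"
  using tangle_defect_decomposition[OF assms] transport_decomposition by metis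

end

lemma tangle_defect_strict:
  assumes R: "cring R" and defects: "defects_give_scalars R \<alpha>" and T: "T \<in> Arr OTa"
    and strict: "\<And>E. elementary_slice E \<Longrightarrow> \<alpha> E = \<one>\<^bsub>R\<^esub>"
  shows "tangle_defect R \<alpha> T = \<one>\<^bsub>R\<^esub>"
proof -
  interpret R: cring R by (rule R)
  obtain Es where Es: "decomposition Es T" "tangle_defect R \<alpha> T = defect_product R \<alpha> Es"
    using tangle_defect_decomposition[OF defects T] .
  have "defect_product R \<alpha> Es = \<one>\<^bsub>R\<^esub>"
    using Es(1)
    by (induction rule: decomposition.induct)
      (auto simp: defect_product_def layer_defect_def layer_def strict)
  then show ?thesis using Es(2) by simp
qed

theorem theorem3p7:
  fixes R0 :: "'r0 ring" and R1 :: "'r1 ring" and \<sigma> :: "'r0 \<Rightarrow> 'r1"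
    and C0 :: "('o0, 'a0, 'r0) linear_cat" and U0 :: "('o0, 'a0, 'r0, 'e0) underlying"
    and C1 D :: "('o1, 'a1, 'r1) linear_cat" and U1 :: "('o1, 'a1, 'r1, 'e1) underlying"
    and Fo0 :: "sign list \<Rightarrow> 'o0" and Fa0 :: "tangle_class \<Rightarrow> 'a0"
    and Fo1 :: "sign list \<Rightarrow> 'o1" and Fa1 :: "tangle_class \<Rightarrow> 'a1"
    and So :: "'o0 \<Rightarrow> 'o1" and Sa :: "'a0 \<Rightarrow> 'a1"
    and \<theta> :: "'o0 \<Rightarrow> ('r1 \<times> 'e0 \<Rightarrow>\<^sub>0 int) set \<Rightarrow> 'e1"
    and J :: "sign list \<Rightarrow> sign list \<Rightarrow> 'a1" and B :: "sign list \<Rightarrow> 'a1"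
    and \<alpha> :: "tangle_class \<Rightarrow> 'r1"
  assumes rings: "cring R0" "cring R1" "\<sigma> \<in> ring_hom R0 R1"
    and C0: "linear_monoidal_category R0 C0" "category_of_modules R0 C0 U0"
      "tensor_unit_is_ring R0 C0 U0" "unit_endos_scalar R0 C0"
    and C1: "linear_monoidal_category R1 C1" "category_of_modules R1 C1 U1"
      "tensor_unit_is_ring R1 C1 U1" "unit_endos_scalar R1 C1"
    and F0: "strict_monoidal_functor OTa C0 Fo0 Fa0"
    and F1: "strict_monoidal_functor OTa C1 Fo1 Fa1"
    and D: "linear_monoidal_category R1 D" "category_of_modules R1 D U1"
    and realized1: "realized_in C1 D R1 (range Fo1) (Fa1 ` Arr OTa)"
    and realized0: "extension_realized_in \<sigma> R0 R1 C0 U0 D U1 (range Fo0) (Fa0 ` Arr OTa) So Sa \<theta>"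
    and B: "\<And>X. B X \<in> Iso D (Fo1 X) (So (Fo0 X))" "B [] = Ide D (Unt D)"
    and coherent: "coherent_comparison D (\<lambda>X. So (Fo0 X)) J B"
    and slices: "\<And>E. elementary_slice E \<Longrightarrow>
      \<alpha> E \<in> Units R1 \<and> Fa1 E = transported D B (\<lambda>T. Sa (Fa0 T)) (\<alpha> E) E"
    and defects: "defects_give_scalars R1 \<alpha>"
  shows "(\<forall>X Y. \<forall>T\<in>Hom OTa X Y.
           Fa1 T = transported D B (\<lambda>T. Sa (Fa0 T)) (tangle_defect R1 \<alpha> T) T) \<and>
         (\<forall>L\<in>Hom OTa [] [].
           closed_invariant R1 C1 Fa1 L =
             tangle_defect R1 \<alpha> L \<otimes>\<^bsub>R1\<^esub> \<sigma> (closed_invariant R0 C0 Fa0 L)) \<and>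
         ((\<forall>E. elementary_slice E \<longrightarrow> \<alpha> E = \<one>\<^bsub>R1\<^esub>) \<longrightarrow>
           (\<forall>L\<in>Hom OTa [] [].
             closed_invariant R1 C1 Fa1 L = \<sigma> (closed_invariant R0 C0 Fa0 L)))"
proof -
  interpret coefficient_extension R0 R1 \<sigma>
    by (intro coefficient_extension.intro rings)
  interpret R1: cring R1 by (rule rings)
  note T0 = strict_monoidal_functor_tangle_functor[OF F0]
    and T1 = strict_monoidal_functor_tangle_functor[OF F1]
  have units: "Fo0 [] = Unt C0" "Fo1 [] = Unt C1"
    using F0 F1 by (simp_all add: strict_monoidal_functor_def OTa_simps)
  have P: "tangle_functor D (\<lambda>X. So (Fo0 X)) (\<lambda>T. Sa (Fa0 T))"
    by (rule extended_tangle_functor[OF C0(1,2) D T0 realized0])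
  have slice: "\<alpha> E \<in> carrier R1 \<and> Fa1 E = transported D B (\<lambda>T. Sa (Fa0 T)) (\<alpha> E) E"
    if "elementary_slice E" for E
    using slices[OF that] R1.Units_closed by blast
  note transport = transport_tangle[OF rings(2) D(1) realized_tangle_functor[OF T1 realized1] P B(1)
      slice defects]
  have tangles: "Fa1 T = transported D B (\<lambda>T. Sa (Fa0 T)) (tangle_defect R1 \<alpha> T) T"
    if "T \<in> Hom OTa X Y" for X Y T
    using transport[of T] HomD[OF that] by blast
  have links: "closed_invariant R1 C1 Fa1 L =
      tangle_defect R1 \<alpha> L \<otimes>\<^bsub>R1\<^esub> \<sigma> (closed_invariant R0 C0 Fa0 L)"
    if L: "L \<in> Hom OTa [] []" for L
  proof -
    note catD = linear_category[OF D(1)]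
    define c where "c = tangle_defect R1 \<alpha> L"
    have c: "c \<in> carrier R1"
      using transport[of L] HomD[OF L] by (simp add: c_def)
    have "Fa0 L \<in> Hom C0 (Unt C0) (Unt C0)"
      using tangle_functorD(1)[OF T0 L] by (simp add: units)
    then obtain r where r: "r \<in> carrier R0" "Fa0 L = Scl C0 r (Ide C0 (Unt C0))"
      using C0(4) unfolding unit_endos_scalar_def by blast
    have SU: "So (Unt C0) = Unt D"
      using realized0 by (simp add: extension_realized_in_def)
    \<comment> \<open>On the tensor unit, coefficient extension sends the scalar \<open>r\<close> to \<open>\<sigma> r\<close>.\<close>
    have SL: "Sa (Fa0 L) = Scl D (\<sigma> r) (Ide D (Unt D))"
    proof -
      have "Unt C0 \<in> range Fo0"
        using units(1) by (metis rangeI)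
      moreover have "Scl C0 r (Ide C0 (Unt C0)) \<in> Fa0 ` Arr OTa"
        using r(2) HomD[OF L] by (metis imageI)
      ultimately show ?thesis
        using Sa_Scl_Ide[OF C0(1,2) D realized0 _ Unt_Obj[OF C0(1)] r(1)] by (simp add: r(2) SU)
    qed
    have UD: "Unt D \<in> Obj D"
      by (rule Unt_Obj[OF D(1)])
    then have I: "Ide D (Unt D) \<in> Hom D (Unt D) (Unt D)"
      using catD by (simp add: category_def)
    \<comment> \<open>The comparison at the empty word is the identity, so only the two scalars remain.\<close>
    note S = Scl_Hom[OF D(1) I \<sigma>_closed[OF r(1)]]
    have "Fa1 L = Scl D c (Ide D (Unt D) \<star>\<^bsub>D\<^esub> Sa (Fa0 L) \<star>\<^bsub>D\<^esub> Ide D (Unt D))"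
      using tangles[OF L] HomD[OF L] by (simp add: transported_def c_def B(2) inv_arr_Ide[OF catD UD])
    also have "\<dots> = Scl D c (Scl D (\<sigma> r) (Ide D (Unt D)))"
      using comp_Ide[OF catD S] by (simp add: SL)
    also have "\<dots> = Scl D (c \<otimes>\<^bsub>R1\<^esub> \<sigma> r) (Ide D (Unt D))"
      by (rule Scl_Scl[OF D(1) I \<sigma>_closed[OF r(1)] c])
    \<comment> \<open>Scalars are only known to agree in the two categories on arrows in the image of \<open>Fa1\<close>; the
      identity of the tensor unit is one of them.\<close>
    also have "\<dots> = Scl C1 (c \<otimes>\<^bsub>R1\<^esub> \<sigma> r) (Ide C1 (Unt C1))"
    proof -
      have eq: "Unt D = Unt C1" "Ide D (Unt C1) = Ide C1 (Unt C1)"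
        using realized1 units(2) unfolding realized_in_def by (metis, metis rangeI)
      have "Fa1 (Ide OTa []) = Ide C1 (Unt C1)"
        by (simp add: tangle_functorD(2)[OF T1] units(2))
      moreover have "Scl D (c \<otimes>\<^bsub>R1\<^esub> \<sigma> r) (Fa1 (Ide OTa [])) = Scl C1 (c \<otimes>\<^bsub>R1\<^esub> \<sigma> r) (Fa1 (Ide OTa []))"
        using realized1 c \<sigma>_closed[OF r(1)] HomD[OF OTa_Ide_Hom[of "[]"]]
        by (simp add: realized_in_def)
      ultimately show ?thesis by (simp only: eq)
    qed
    finally have "closed_invariant R1 C1 Fa1 L = c \<otimes>\<^bsub>R1\<^esub> \<sigma> r"
      using c \<sigma>_closed[OF r(1)] by (intro closed_invariant_eqI[OF C1(1-3) rings(2)]) simp_all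
    moreover have "closed_invariant R0 C0 Fa0 L = r"
      by (rule closed_invariant_eqI[where Fa = Fa0 and L = L, OF C0(1-3) rings(1) r])
    ultimately show ?thesis by (simp add: c_def)
  qed
  have strict: "closed_invariant R1 C1 Fa1 L = \<sigma> (closed_invariant R0 C0 Fa0 L)"
    if one: "\<forall>E. elementary_slice E \<longrightarrow> \<alpha> E = \<one>\<^bsub>R1\<^esub>" and L: "L \<in> Hom OTa [] []" for L
  proof -
    have "tangle_defect R1 \<alpha> L = \<one>\<^bsub>R1\<^esub>"
      using one HomD[OF L] by (intro tangle_defect_strict[OF rings(2) defects]) blast+
    moreover obtain r where "r \<in> carrier R0" "Fa0 L = Scl C0 r (Ide C0 (Unt C0))"
      using C0(4) tangle_functorD(1)[OF T0 L] units(1) unfolding unit_endos_scalar_def by metis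
    then have "\<sigma> (closed_invariant R0 C0 Fa0 L) \<in> carrier R1"
      using closed_invariant_eqI[OF C0(1-3) rings(1)] \<sigma>_closed by metis
    ultimately show ?thesis
      using links[OF L] by simp
  qed
  show ?thesis
    using tangles links strict by blast
qed

end
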